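(* Let $n\geq 4$ and let $G$ be one of the groups $\operatorname{GL}_n(\mathbb{Z})$, $\operatorname{PGL}_n(\mathbb{Z})$, $\operatorname{SL}_n(\mathbb{Z})$, or $\operatorname{PSL}_n(\mathbb{Z})$. There exist matrices $h_1,\ldots,h_s;g\in G$ such that $g$ is algebraic over $H=\langle h_1,\ldots,h_s\rangle\leqslant G$ but the ideal $I_H(g)$ is not finitely generated, even as a normal subgroup of $H*\langle x\rangle$.
   Context: For a group $G$, a subgroup $H\leqslant G$ and an element $g\in G$, let $H*\langle x\rangle$ be the free product of $H$ with the infinite cyclic group generated by a variable $x$. For $w(x)\in H*\langle x\rangle$, $w(g)\in G$ denotes the image of $w(x)$ under the homomorphism $H*\langle x\rangle\to G$ that is the inclusion on $H$ and sends $x\mapsto g$. The ideal of $g$ over $H$ is the normal subgroup $I_H(g)=\{w(x)\in H*\langle x\rangle\mid w(g)=1\}$ of $H*\langle x\rangle$. The element $g$ is algebraic over $H$ if there is a non-trivial $w(x)\in H*\langle x\rangle$ with $w(g)=1$, i.e. if $I_H(g)\neq\{1\}$. $\operatorname{GL}_n(\mathbb{Z})$ is the group of invertible $n\times n$ matrices over the integers, $\operatorname{SL}_n(\mathbb{Z})$ its subgroup of determinant $1$ matrices, and $\operatorname{PGL}_n(\mathbb{Z})$, $\operatorname{PSL}_n(\mathbb{Z})$ their respective quotients by their centers (the scalar matrices they contain); elements of these quotients are represented by integral matrices. *)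

theory Defs
  imports
    "HOL-Algebra.Algebra"
    "Jordan_Normal_Form.Determinant"
begin

section \<open>Free products\<close>

definition fp_words :: "('a, 'x) monoid_scheme \<Rightarrow> ('b, 'y) monoid_scheme \<Rightarrow> ('a + 'b) list set" where
  "fp_words G K = lists (Inl ` carrier G \<union> Inr ` carrier K)"

text \<open>The least congruence on words that multiplies adjacent letters from the same factor and
  erases the neutral elements of both factors.\<close>

inductive fp_cong ::
  "('a, 'x) monoid_scheme \<Rightarrow> ('b, 'y) monoid_scheme \<Rightarrow> ('a + 'b) list \<Rightarrow> ('a + 'b) list \<Rightarrow> bool"
  for G K where
  fp_refl: "u \<in> fp_words G K \<Longrightarrow> fp_cong G K u u"
| fp_sym: "fp_cong G K u v \<Longrightarrow> fp_cong G K v u"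
| fp_trans: "fp_cong G K u v \<Longrightarrow> fp_cong G K v w \<Longrightarrow> fp_cong G K u w"
| fp_append: "fp_cong G K u u' \<Longrightarrow> fp_cong G K v v' \<Longrightarrow> fp_cong G K (u @ v) (u' @ v')"
| fp_one_left: "fp_cong G K [Inl \<one>\<^bsub>G\<^esub>] []"
| fp_one_right: "fp_cong G K [Inr \<one>\<^bsub>K\<^esub>] []"
| fp_mult_left: "a \<in> carrier G \<Longrightarrow> b \<in> carrier G \<Longrightarrow> fp_cong G K [Inl a, Inl b] [Inl (a \<otimes>\<^bsub>G\<^esub> b)]"
| fp_mult_right: "a \<in> carrier K \<Longrightarrow> b \<in> carrier K \<Longrightarrow> fp_cong G K [Inr a, Inr b] [Inr (a \<otimes>\<^bsub>K\<^esub> b)]"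

definition fp_rel ::
  "('a, 'x) monoid_scheme \<Rightarrow> ('b, 'y) monoid_scheme \<Rightarrow> ('a + 'b) list rel" where
  "fp_rel G K = {(u, v). fp_cong G K u v}"

definition free_product ::
  "('a, 'x) monoid_scheme \<Rightarrow> ('b, 'y) monoid_scheme \<Rightarrow> ('a + 'b) list set monoid" where
  "free_product G K =
    \<lparr>carrier = fp_words G K // fp_rel G K,
     monoid.mult = (\<lambda>U V. \<Union>u\<in>U. \<Union>v\<in>V. fp_rel G K `` {u @ v}),
     one = fp_rel G K `` {[]}\<rparr>"

definition fp_word_eval ::
  "('c, 'z) monoid_scheme \<Rightarrow> ('a \<Rightarrow> 'c) \<Rightarrow> ('b \<Rightarrow> 'c) \<Rightarrow> ('a + 'b) list \<Rightarrow> 'c" where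
  "fp_word_eval L \<phi> \<psi> w = foldr (\<lambda>l y. case_sum \<phi> \<psi> l \<otimes>\<^bsub>L\<^esub> y) w \<one>\<^bsub>L\<^esub>"

text \<open>The homomorphism out of the free product that restricts to \<open>\<phi>\<close> and \<open>\<psi>\<close> on the two factors.\<close>

definition fp_lift ::
  "('c, 'z) monoid_scheme \<Rightarrow> ('a \<Rightarrow> 'c) \<Rightarrow> ('b \<Rightarrow> 'c) \<Rightarrow> ('a + 'b) list set \<Rightarrow> 'c" where
  "fp_lift L \<phi> \<psi> W = the_elem (fp_word_eval L \<phi> \<psi> ` W)"

lemma fp_cong_words:
  assumes "fp_cong G K u v" "group G" "group K"
  shows "u \<in> fp_words G K \<and> v \<in> fp_words G K"
proof -
  interpret G: group G by fact
  interpret K: group K by fact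
  show ?thesis
    using assms(1) by (induction rule: fp_cong.induct) (auto simp: fp_words_def)
qed

lemma equiv_fp_rel:
  assumes "group G" "group K"
  shows "equiv (fp_words G K) (fp_rel G K)"
  using fp_cong_words[OF _ assms]
  by (intro equivI refl_onI symI transI) (auto simp: fp_rel_def intro: fp_cong.intros)

lemma fp_mult_class:
  assumes "group G" "group K" "u \<in> fp_words G K" "v \<in> fp_words G K"
  shows "(fp_rel G K `` {u}) \<otimes>\<^bsub>free_product G K\<^esub> (fp_rel G K `` {v}) = fp_rel G K `` {u @ v}"
proof -
  have eq: "equiv (fp_words G K) (fp_rel G K)"
    using assms equiv_fp_rel by blast
  have "congruent2 (fp_rel G K) (fp_rel G K) (\<lambda>u v. fp_rel G K `` {u @ v})"
    by (rule congruent2I', rule equiv_class_eq[OF eq]) (auto simp: fp_rel_def intro: fp_append)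
  from UN_equiv_class2[OF eq eq this] assms show ?thesis
    by (simp add: free_product_def)
qed

lemma fp_class_in_carrier:
  "u \<in> fp_words G K \<Longrightarrow> fp_rel G K `` {u} \<in> carrier (free_product G K)"
  by (simp add: free_product_def quotientI)

lemma fp_carrierE:
  assumes "W \<in> carrier (free_product G K)"
  obtains u where "u \<in> fp_words G K" "W = fp_rel G K `` {u}"
  using assms by (auto simp: free_product_def elim: quotientE)

lemma fp_class_eqI:
  assumes "group G" "group K" "fp_cong G K u v"
  shows "fp_rel G K `` {u} = fp_rel G K `` {v}"
  using equiv_class_eq[OF equiv_fp_rel[OF assms(1,2)]] assms(3) by (simp add: fp_rel_def)

lemma fp_left_inverse:
  assumes "group G" "group K" "u \<in> fp_words G K"
  shows "\<exists>v\<in>fp_words G K. fp_cong G K (v @ u) []"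
proof -
  interpret G: group G by fact
  interpret K: group K by fact
  have "u \<in> lists (Inl ` carrier G \<union> Inr ` carrier K)"
    using assms(3) by (simp add: fp_words_def)
  then show ?thesis
  proof (induction u rule: lists.induct)
    case Nil
    show ?case by (rule bexI[of _ "[]"]) (auto simp: fp_words_def intro!: fp_refl)
  next
    case (Cons l u)
    then obtain v where v: "v \<in> fp_words G K" "fp_cong G K (v @ u) []" by blast
    have u: "u \<in> fp_words G K" using Cons by (simp add: fp_words_def)
    have "\<exists>m. [m] \<in> fp_words G K \<and> fp_cong G K [m, l] []"
    proof (cases l)
      case (Inl a)
      then have a: "a \<in> carrier G" using Cons by auto
      then have "fp_cong G K [Inl (inv\<^bsub>G\<^esub> a), Inl a] []"
        using fp_mult_left[of "inv\<^bsub>G\<^esub> a" G a K] fp_trans[OF _ fp_one_left] by fastforce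
      then show ?thesis using a Inl by (auto simp: fp_words_def intro!: exI[of _ "Inl (inv\<^bsub>G\<^esub> a)"])
    next
      case (Inr a)
      then have a: "a \<in> carrier K" using Cons by auto
      then have "fp_cong G K [Inr (inv\<^bsub>K\<^esub> a), Inr a] []"
        using fp_mult_right[of "inv\<^bsub>K\<^esub> a" K a G] fp_trans[OF _ fp_one_right] by fastforce
      then show ?thesis using a Inr by (auto simp: fp_words_def intro!: exI[of _ "Inr (inv\<^bsub>K\<^esub> a)"])
    qed
    then obtain m where m: "[m] \<in> fp_words G K" "fp_cong G K [m, l] []" by blast
    have "fp_cong G K (v @ [m, l] @ u) (v @ [] @ u)"
      using v u m by (intro fp_append fp_refl)
    then have "fp_cong G K ((v @ [m]) @ l # u) []"
      using v(2) fp_trans by fastforce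
    moreover have "v @ [m] \<in> fp_words G K" using v m by (auto simp: fp_words_def)
    ultimately show ?case by blast
  qed
qed

lemma group_free_product:
  assumes "group G" "group K"
  shows "group (free_product G K)"
proof -
  have app: "u @ v \<in> fp_words G K" if "u \<in> fp_words G K" "v \<in> fp_words G K" for u v
    using that by (auto simp: fp_words_def)
  have nil: "[] \<in> fp_words G K" by (simp add: fp_words_def)
  have one: "\<one>\<^bsub>free_product G K\<^esub> = fp_rel G K `` {[]}" by (simp add: free_product_def)
  show ?thesis
  proof (rule groupI)
    fix U assume "U \<in> carrier (free_product G K)"
    then obtain u where u: "u \<in> fp_words G K" "U = fp_rel G K `` {u}" by (rule fp_carrierE)
    show "\<one>\<^bsub>free_product G K\<^esub> \<otimes>\<^bsub>free_product G K\<^esub> U = U"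
      using u nil by (simp add: one fp_mult_class[OF assms])
    obtain v where "v \<in> fp_words G K" "fp_cong G K (v @ u) []"
      using fp_left_inverse[OF assms u(1)] by blast
    then have "(fp_rel G K `` {v}) \<otimes>\<^bsub>free_product G K\<^esub> U = \<one>\<^bsub>free_product G K\<^esub>"
      using u by (simp add: one fp_mult_class[OF assms] fp_class_eqI[OF assms])
    then show "\<exists>V\<in>carrier (free_product G K). V \<otimes>\<^bsub>free_product G K\<^esub> U = \<one>\<^bsub>free_product G K\<^esub>"
      using \<open>v \<in> fp_words G K\<close> fp_class_in_carrier by blast
  qed (auto elim!: fp_carrierE simp: one nil app fp_class_in_carrier fp_mult_class[OF assms])
qed

lemma fp_word_eval_append:
  assumes "group L" "\<phi> \<in> carrier G \<rightarrow> carrier L" "\<psi> \<in> carrier K \<rightarrow> carrier L"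
    "u \<in> fp_words G K" "v \<in> fp_words G K"
  shows "fp_word_eval L \<phi> \<psi> u \<in> carrier L"
    and "fp_word_eval L \<phi> \<psi> (u @ v) = fp_word_eval L \<phi> \<psi> u \<otimes>\<^bsub>L\<^esub> fp_word_eval L \<phi> \<psi> v"
proof -
  interpret L: group L by fact
  have l: "case_sum \<phi> \<psi> l \<in> carrier L" if "l \<in> Inl ` carrier G \<union> Inr ` carrier K" for l
    using that assms by auto
  have c: "fp_word_eval L \<phi> \<psi> w \<in> carrier L" if "w \<in> fp_words G K" for w
    using that unfolding fp_words_def
    by (induction w rule: lists.induct) (use l in \<open>auto simp: fp_word_eval_def\<close>)
  show "fp_word_eval L \<phi> \<psi> u \<in> carrier L" by (rule c) fact
  have "u \<in> lists (Inl ` carrier G \<union> Inr ` carrier K)" using assms by (simp add: fp_words_def)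
  then show "fp_word_eval L \<phi> \<psi> (u @ v) = fp_word_eval L \<phi> \<psi> u \<otimes>\<^bsub>L\<^esub> fp_word_eval L \<phi> \<psi> v"
  proof (induction u rule: lists.induct)
    case Nil
    then show ?case using c[OF assms(5)] by (simp add: fp_word_eval_def)
  next
    case (Cons a u)
    then have "u \<in> fp_words G K" by (simp add: fp_words_def)
    with Cons l[OF Cons(1)] c[OF this] c[OF assms(5)] show ?case
      by (simp add: fp_word_eval_def L.m_assoc)
  qed
qed

lemma fp_word_eval_cong:
  assumes "group G" "group K" "group L" "\<phi> \<in> hom G L" "\<psi> \<in> hom K L" "fp_cong G K u v"
  shows "fp_word_eval L \<phi> \<psi> u = fp_word_eval L \<phi> \<psi> v"
proof -
  interpret L: group L by fact
  have maps: "\<phi> \<in> carrier G \<rightarrow> carrier L" "\<psi> \<in> carrier K \<rightarrow> carrier L"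
    using assms by (auto simp: hom_def)
  have app: "fp_word_eval L \<phi> \<psi> (u @ v) = fp_word_eval L \<phi> \<psi> u \<otimes>\<^bsub>L\<^esub> fp_word_eval L \<phi> \<psi> v"
    if "u \<in> fp_words G K" "v \<in> fp_words G K" for u v
    using fp_word_eval_append(2)[OF assms(3) maps that] .
  show ?thesis
    using assms(6)
  proof (induction rule: fp_cong.induct)
    case (fp_append u u' v v')
    then show ?case
      using fp_cong_words[OF fp_append(1) assms(1,2)] fp_cong_words[OF fp_append(2) assms(1,2)]
      by (simp add: app)
  next
    case fp_one_left
    then show ?case
      using hom_one[OF assms(4,1,3)] by (simp add: fp_word_eval_def)
  next
    case fp_one_right
    then show ?case
      using hom_one[OF assms(5,2,3)] by (simp add: fp_word_eval_def)
  next
    case (fp_mult_left a b)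
    moreover from this have "\<phi> a \<in> carrier L" "\<phi> b \<in> carrier L"
      using maps by auto
    ultimately show ?case
      by (simp add: fp_word_eval_def hom_mult[OF assms(4)])
  next
    case (fp_mult_right a b)
    moreover from this have "\<psi> a \<in> carrier L" "\<psi> b \<in> carrier L"
      using maps by auto
    ultimately show ?case
      by (simp add: fp_word_eval_def hom_mult[OF assms(5)])
  qed simp_all
qed

lemma fp_lift_class:
  assumes "group G" "group K" "group L" "\<phi> \<in> hom G L" "\<psi> \<in> hom K L" "u \<in> fp_words G K"
  shows "fp_lift L \<phi> \<psi> (fp_rel G K `` {u}) = fp_word_eval L \<phi> \<psi> u"
proof -
  have "fp_word_eval L \<phi> \<psi> ` (fp_rel G K `` {u}) = {fp_word_eval L \<phi> \<psi> u}"
  proof (rule equalityI)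
    show "{fp_word_eval L \<phi> \<psi> u} \<subseteq> fp_word_eval L \<phi> \<psi> ` (fp_rel G K `` {u})"
      using fp_refl[OF assms(6)] by (auto simp: fp_rel_def)
    show "fp_word_eval L \<phi> \<psi> ` (fp_rel G K `` {u}) \<subseteq> {fp_word_eval L \<phi> \<psi> u}"
    proof clarify
      fix v assume "(u, v) \<in> fp_rel G K"
      then have "fp_cong G K u v" by (simp add: fp_rel_def)
      from fp_word_eval_cong[OF assms(1-5) this]
      show "fp_word_eval L \<phi> \<psi> v = fp_word_eval L \<phi> \<psi> u" by simp
    qed
  qed
  then show ?thesis by (simp add: fp_lift_def)
qed

lemma fp_lift_hom:
  assumes "group G" "group K" "group L" "\<phi> \<in> hom G L" "\<psi> \<in> hom K L"
  shows "fp_lift L \<phi> \<psi> \<in> hom (free_product G K) L"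
proof -
  have maps: "\<phi> \<in> carrier G \<rightarrow> carrier L" "\<psi> \<in> carrier K \<rightarrow> carrier L"
    using assms by (auto simp: hom_def)
  have app: "u @ v \<in> fp_words G K" if "u \<in> fp_words G K" "v \<in> fp_words G K" for u v
    using that by (auto simp: fp_words_def)
  show ?thesis
  proof (rule homI)
    fix U assume "U \<in> carrier (free_product G K)"
    then obtain u where "u \<in> fp_words G K" "U = fp_rel G K `` {u}" by (rule fp_carrierE)
    then show "fp_lift L \<phi> \<psi> U \<in> carrier L"
      using fp_word_eval_append(1)[OF assms(3) maps] by (simp add: fp_lift_class[OF assms])
  next
    fix U V assume U: "U \<in> carrier (free_product G K)" and V: "V \<in> carrier (free_product G K)"
    obtain u where u: "u \<in> fp_words G K" "U = fp_rel G K `` {u}" using U by (rule fp_carrierE)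
    obtain v where v: "v \<in> fp_words G K" "V = fp_rel G K `` {v}" using V by (rule fp_carrierE)
    show "fp_lift L \<phi> \<psi> (U \<otimes>\<^bsub>free_product G K\<^esub> V) = fp_lift L \<phi> \<psi> U \<otimes>\<^bsub>L\<^esub> fp_lift L \<phi> \<psi> V"
      using u v app fp_word_eval_append(2)[OF assms(3) maps u(1) v(1)]
      by (simp add: fp_lift_class[OF assms] fp_mult_class[OF assms(1,2)])
  qed
qed


section \<open>Equations over a subgroup\<close>

text \<open>The infinite cyclic group generated by the variable \<open>x\<close> is \<^const>\<open>integer_group\<close>, with
  \<open>k\<close> standing for \<open>x\<^sup>k\<close>.\<close>

definition adjoin_var :: "('a, 'x) monoid_scheme \<Rightarrow> 'a set \<Rightarrow> ('a + int) list set monoid" where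
  "adjoin_var G H = free_product (G\<lparr>carrier := H\<rparr>) integer_group"

definition eval_at :: "('a, 'x) monoid_scheme \<Rightarrow> 'a \<Rightarrow> ('a + int) list set \<Rightarrow> 'a" where
  "eval_at G g = fp_lift G (\<lambda>h. h) (\<lambda>k::int. g [^]\<^bsub>G\<^esub> k)"

definition equation_ideal ::
  "('a, 'x) monoid_scheme \<Rightarrow> 'a set \<Rightarrow> 'a \<Rightarrow> ('a + int) list set set" where
  "equation_ideal G H g = {w \<in> carrier (adjoin_var G H). eval_at G g w = \<one>\<^bsub>G\<^esub>}"

definition algebraic_elem :: "('a, 'x) monoid_scheme \<Rightarrow> 'a set \<Rightarrow> 'a \<Rightarrow> bool" where
  "algebraic_elem G H g \<longleftrightarrow>
    (\<exists>w\<in>carrier (adjoin_var G H). w \<noteq> \<one>\<^bsub>adjoin_var G H\<^esub> \<and> eval_at G g w = \<one>\<^bsub>G\<^esub>)"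

definition normal_closure :: "('a, 'x) monoid_scheme \<Rightarrow> 'a set \<Rightarrow> 'a set" where
  "normal_closure G S = \<Inter>{N. N \<lhd> G \<and> S \<subseteq> N}"

definition fin_gen_as_normal :: "('a, 'x) monoid_scheme \<Rightarrow> 'a set \<Rightarrow> bool" where
  "fin_gen_as_normal G N \<longleftrightarrow> (\<exists>S. finite S \<and> S \<subseteq> carrier G \<and> N = normal_closure G S)"

lemma group_adjoin_var:
  assumes "group G" "subgroup H G"
  shows "group (adjoin_var G H)"
  unfolding adjoin_var_def
  by (rule group_free_product) (simp_all add: assms subgroup.subgroup_is_group)

lemma eval_at_hom:
  assumes "group G" "subgroup H G" "g \<in> carrier G"
  shows "eval_at G g \<in> hom (adjoin_var G H) G"
  unfolding adjoin_var_def eval_at_def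
proof (rule fp_lift_hom)
  show "(\<lambda>h. h) \<in> hom (G\<lparr>carrier := H\<rparr>) G"
    using subgroup.mem_carrier[OF assms(2)] by (auto simp: hom_def)
qed (use assms in \<open>simp_all add: subgroup.subgroup_is_group group.hom_integer_group_pow\<close>)

lemma equation_ideal_normal:
  assumes "group G" "subgroup H G" "g \<in> carrier G"
  shows "equation_ideal G H g \<lhd> adjoin_var G H"
proof -
  have "group_hom (adjoin_var G H) G (eval_at G g)"
    using assms(1) group_adjoin_var[OF assms(1,2)] eval_at_hom[OF assms]
    by (simp add: group_hom_def group_hom_axioms_def)
  from group_hom.normal_kernel[OF this] show ?thesis
    by (simp add: kernel_def equation_ideal_def)
qed

lemma algebraic_elem_iff_ideal:
  assumes "group G" "subgroup H G" "g \<in> carrier G"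
  shows "algebraic_elem G H g \<longleftrightarrow> equation_ideal G H g \<noteq> {\<one>\<^bsub>adjoin_var G H\<^esub>}"
proof -
  have "\<one>\<^bsub>adjoin_var G H\<^esub> \<in> equation_ideal G H g"
    using equation_ideal_normal[OF assms] by (simp add: normal_def subgroup.one_closed)
  then show ?thesis
    unfolding algebraic_elem_def equation_ideal_def by blast
qed


section \<open>Integral linear groups\<close>

definition group_center :: "('a, 'x) monoid_scheme \<Rightarrow> 'a set" where
  "group_center G = {z \<in> carrier G. \<forall>y\<in>carrier G. z \<otimes>\<^bsub>G\<^esub> y = y \<otimes>\<^bsub>G\<^esub> z}"

definition GL_int :: "nat \<Rightarrow> int mat monoid" where
  "GL_int n = units_of (ring_mat TYPE(int) n ())"

definition SL_int :: "nat \<Rightarrow> int mat monoid" where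
  "SL_int n = (GL_int n)\<lparr>carrier := {A \<in> carrier (GL_int n). det A = 1}\<rparr>"

definition PGL_int :: "nat \<Rightarrow> int mat set monoid" where
  "PGL_int n = GL_int n Mod group_center (GL_int n)"

definition PSL_int :: "nat \<Rightarrow> int mat set monoid" where
  "PSL_int n = SL_int n Mod group_center (SL_int n)"

lemma group_center_normal:
  fixes G (structure)
  assumes "group G"
  shows "group_center G \<lhd> G"
proof -
  interpret group G by fact
  have sub: "subgroup (group_center G) G"
  proof (rule subgroupI)
    show "group_center G \<noteq> {}" by (auto simp: group_center_def intro!: exI[of _ \<one>])
  next
    fix z assume z: "z \<in> group_center G"
    have "inv z \<otimes> y = y \<otimes> inv z" if y: "y \<in> carrier G" for y
    proof -
      have "z \<in> carrier G" "z \<otimes> inv y = inv y \<otimes> z"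
        using z y by (auto simp: group_center_def)
      then have "inv (z \<otimes> inv y) = inv (inv y \<otimes> z)" by simp
      with \<open>z \<in> carrier G\<close> y show ?thesis by (simp add: inv_mult_group)
    qed
    with z show "inv z \<in> group_center G" by (auto simp: group_center_def)
  next
    fix y z assume "y \<in> group_center G" "z \<in> group_center G"
    then have yz: "y \<in> carrier G" "z \<in> carrier G"
      and y: "\<And>t. t \<in> carrier G \<Longrightarrow> y \<otimes> t = t \<otimes> y"
      and z: "\<And>t. t \<in> carrier G \<Longrightarrow> z \<otimes> t = t \<otimes> z"
      by (auto simp: group_center_def)
    have "y \<otimes> z \<otimes> t = t \<otimes> (y \<otimes> z)" if t: "t \<in> carrier G" for t
    proof -
      have "y \<otimes> z \<otimes> t = y \<otimes> (t \<otimes> z)" using yz t z by (simp add: m_assoc)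
      also have "\<dots> = (y \<otimes> t) \<otimes> z" using yz t by (simp add: m_assoc)
      also have "\<dots> = (t \<otimes> y) \<otimes> z" using t y by simp
      also have "\<dots> = t \<otimes> (y \<otimes> z)" using yz t by (simp add: m_assoc)
      finally show ?thesis .
    qed
    with yz show "y \<otimes> z \<in> group_center G" by (simp add: group_center_def)
  qed (auto simp: group_center_def)
  moreover have "y \<otimes> z \<otimes> inv y \<in> group_center G" if "y \<in> carrier G" "z \<in> group_center G" for y z
  proof -
    have "y \<otimes> z \<otimes> inv y = z \<otimes> y \<otimes> inv y" using that by (simp add: group_center_def)
    also have "\<dots> = z \<otimes> (y \<otimes> inv y)" using that by (intro m_assoc) (auto simp: group_center_def)
    also have "\<dots> = z" using that by (simp add: group_center_def)
    finally show ?thesis using that by simp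
  qed
  ultimately show ?thesis by (simp add: normal_inv_iff)
qed

lemma group_GL_int: "group (GL_int n)"
  unfolding GL_int_def
  by (rule monoid.units_group) (rule ring.is_monoid[OF ring_mat])

lemma group_SL_int: "group (SL_int n)"
proof -
  interpret group "GL_int n" by (rule group_GL_int)
  have car: "A \<in> carrier_mat n n" if "A \<in> carrier (GL_int n)" for A
    using that by (auto simp: GL_int_def units_of_def Units_def ring_mat_def)
  have mult: "A \<otimes>\<^bsub>GL_int n\<^esub> B = A * B" for A B
    by (simp add: GL_int_def units_of_def ring_mat_def)
  have one: "\<one>\<^bsub>GL_int n\<^esub> = 1\<^sub>m n"
    by (simp add: GL_int_def units_of_def ring_mat_def)
  have det: "det (A \<otimes>\<^bsub>GL_int n\<^esub> B) = det A * det B"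
    if "A \<in> carrier (GL_int n)" "B \<in> carrier (GL_int n)" for A B
    using det_mult[OF car[OF that(1)] car[OF that(2)]] by (simp add: mult)
  have "subgroup {A \<in> carrier (GL_int n). det A = 1} (GL_int n)"
  proof (rule subgroupI)
    show "{A \<in> carrier (GL_int n). det A = 1} \<noteq> {}"
      using one_closed by (auto simp: one intro!: exI[of _ "1\<^sub>m n"])
  next
    fix A assume A: "A \<in> {A \<in> carrier (GL_int n). det A = 1}"
    then have "det A * det (inv\<^bsub>GL_int n\<^esub> A) = det (1\<^sub>m n :: int mat)"
      using det[of A "inv\<^bsub>GL_int n\<^esub> A"] by (simp add: one)
    with A show "inv\<^bsub>GL_int n\<^esub> A \<in> {A \<in> carrier (GL_int n). det A = 1}" by simp
  qed (auto simp: det)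
  then show ?thesis
    unfolding SL_int_def by (rule subgroup.subgroup_is_group) (rule group_GL_int)
qed

lemma group_PGL_int: "group (PGL_int n)"
  unfolding PGL_int_def
  by (intro normal.factorgroup_is_group group_center_normal group_GL_int)

lemma group_PSL_int: "group (PSL_int n)"
  unfolding PSL_int_def
  by (intro normal.factorgroup_is_group group_center_normal group_SL_int)

end

theory Submission
  imports Defs
begin

text \<open>
  Let \<open>U\<close> be a subgroup of \<open>H\<close> that commutes with \<open>g\<close> and is not finitely generated.  If the ideal of
  \<open>g\<close> over \<open>H\<close> is the normal closure of the commutators \<open>[x, u]\<close> with \<open>u \<in> U\<close>, then it cannot be
  generated by finitely many elements as a normal subgroup: those elements would lie in the normal
  closure of \<open>[x, u]\<close> for \<open>u\<close> in some finite \<open>F \<subseteq> U\<close>, whereas \<open>[x, u]\<close> lies in that normal closure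
  only if \<open>u\<close> is in the subgroup generated by \<open>F\<close> (\<open>commutator_in_finite_closure\<close>).  The last
  claim holds because every subgroup \<open>V\<close> of \<open>H\<close> is the centralizer in \<open>H\<close> of some element \<open>s\<close> of
  a larger permutation group (\<open>subgroup_is_centralizer\<close>), and \<open>x\<close> can be sent to \<open>s\<close>.

  Such \<open>H\<close>, \<open>g\<close> and \<open>U\<close> exist in \<open>SL\<^sub>2(\<int>) \<times> SL\<^sub>2(\<int>)\<close>, which sits in \<open>SL\<^sub>n(\<int>)\<close> as two diagonal
  blocks as soon as \<open>n \<ge> 4\<close>.  Let \<open>a\<close> and \<open>b\<close> be the upper and the lower unitriangular matrix with
  off-diagonal entry \<open>2\<close>, let \<open>H\<close> be generated by \<open>\<alpha> = (a, a)\<close> and \<open>(b, 1)\<close>, and let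
  \<open>g = (1, b)\<close>.  The conjugates \<open>a\<^sup>k b a\<^sup>-\<^sup>k\<close> with \<open>k \<in> \<int>\<close> freely generate a subgroup of
  \<open>SL\<^sub>2(\<int>)\<close>, by ping-pong (\<open>transvections_ping_pong\<close>); hence \<open>U\<close>, the same subgroup in the
  first block, is not finitely generated, and it commutes with \<open>g\<close>.

  The ideal is generated by the \<open>[x, u]\<close> because modulo these commutators \<open>U\<close> is centralized by
  \<open>x\<close> and normalized by \<open>\<alpha>\<close>, so that every element of \<open>H * \<langle>x\<rangle>\<close> can be brought into the form
  \<open>u w \<alpha>\<^sup>e\<close> with \<open>u \<in> U\<close> and \<open>w\<close> a reduced word in the elements \<open>\<alpha>\<^sup>k x \<alpha>\<^sup>-\<^sup>k\<close>
  (\<open>conj_word_normal_form\<close>).  Substituting \<open>g\<close> for \<open>x\<close> and looking at the second block, where \<open>w\<close>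
  becomes a reduced word in the free elements \<open>a\<^sup>k b a\<^sup>-\<^sup>k\<close>, shows that the value can be \<open>1\<close> only if
  \<open>w\<close> is empty and \<open>e = 0\<close>, and then the first block gives \<open>u = 1\<close>.

  The ping-pong argument produces a nonzero off-diagonal entry and not merely a matrix different
  from \<open>1\<close>.  Therefore it survives every homomorphism out of \<open>SL\<^sub>n(\<int>)\<close> whose kernel consists of
  diagonal matrices (\<open>ideal_not_fin_gen_in_image\<close>), and one argument serves all four groups.
\<close>

section \<open>Words in conjugates\<close>

definition conj_pow :: "('a, 'x) monoid_scheme \<Rightarrow> 'a \<Rightarrow> 'a \<Rightarrow> int \<Rightarrow> int \<Rightarrow> 'a" where
  "conj_pow G a c k j = a [^]\<^bsub>G\<^esub> k \<otimes>\<^bsub>G\<^esub> c [^]\<^bsub>G\<^esub> j \<otimes>\<^bsub>G\<^esub> a [^]\<^bsub>G\<^esub> (- k)"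

text \<open>The word \<open>(k\<^sub>1, j\<^sub>1), \<dots>, (k\<^sub>r, j\<^sub>r)\<close> stands for the product of the powers \<open>(a\<^sup>k c a\<^sup>-\<^sup>k)\<^sup>j\<close>; these
  lists are the syllable forms of elements of the free group with basis \<open>\<int>\<close>.\<close>

definition conj_word :: "('a, 'x) monoid_scheme \<Rightarrow> 'a \<Rightarrow> 'a \<Rightarrow> (int \<times> int) list \<Rightarrow> 'a" where
  "conj_word G a c ks = foldr (\<lambda>(k, j) y. conj_pow G a c k j \<otimes>\<^bsub>G\<^esub> y) ks \<one>\<^bsub>G\<^esub>"

definition reduced :: "(int \<times> int) list \<Rightarrow> bool" where
  "reduced ks \<longleftrightarrow> distinct_adj (map fst ks) \<and> (\<forall>(k, j)\<in>set ks. j \<noteq> 0)"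

definition free_conjugates :: "('a, 'x) monoid_scheme \<Rightarrow> 'a \<Rightarrow> 'a \<Rightarrow> bool" where
  "free_conjugates G a c \<longleftrightarrow> (\<forall>ks. reduced ks \<longrightarrow> conj_word G a c ks = \<one>\<^bsub>G\<^esub> \<longrightarrow> ks = [])"

lemma reduced_Nil [simp]: "reduced []"
  by (simp add: reduced_def)

lemma reduced_Cons:
  "reduced ((k, j) # ks) \<longleftrightarrow> j \<noteq> 0 \<and> reduced ks \<and> (ks = [] \<or> fst (hd ks) \<noteq> k)"
  by (cases ks) (auto simp: reduced_def)

lemma reduced_shift:
  "reduced ks \<Longrightarrow> reduced (map (\<lambda>(k, j). (i + k, j)) ks)"
proof (induction ks)
  case (Cons p ks)
  then show ?case by (cases p; cases ks) (auto simp: reduced_Cons)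
qed simp

lemma conj_word_Nil [simp]: "conj_word G a c [] = \<one>\<^bsub>G\<^esub>"
  by (simp add: conj_word_def)

lemma conj_word_Cons [simp]:
  "conj_word G a c ((k, j) # ks) = conj_pow G a c k j \<otimes>\<^bsub>G\<^esub> conj_word G a c ks"
  by (simp add: conj_word_def)

lemma hom_conj_pow:
  assumes "group G" "group L" "f \<in> hom G L" "a \<in> carrier G" "c \<in> carrier G"
  shows "f (conj_pow G a c k j) = conj_pow L (f a) (f c) k j"
proof -
  interpret G: group G by fact
  interpret f: group_hom G L f
    using assms by (simp add: group_hom_def group_hom_axioms_def)
  show ?thesis using assms by (simp add: conj_pow_def f.hom_int_pow)
qed

lemma (in group) cancel_mid:
  assumes "x \<in> carrier G" "y \<in> carrier G" "u \<in> carrier G" "v \<in> carrier G" "u \<otimes> v = \<one>"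
  shows "x \<otimes> u \<otimes> (v \<otimes> y) = x \<otimes> y"
  using assms by (metis m_assoc m_closed r_one l_one)

context group begin

lemma conj_pow_closed [simp]:
  "a \<in> carrier G \<Longrightarrow> c \<in> carrier G \<Longrightarrow> conj_pow G a c k j \<in> carrier G"
  by (simp add: conj_pow_def)

lemma conj_word_closed [simp]:
  assumes "a \<in> carrier G" "c \<in> carrier G"
  shows "conj_word G a c ks \<in> carrier G"
  using assms by (induction ks) auto

lemma conj_pow_0 [simp]: "a \<in> carrier G \<Longrightarrow> c \<in> carrier G \<Longrightarrow> conj_pow G a c k 0 = \<one>"
  by (simp add: conj_pow_def int_pow_neg)

lemma conj_pow_base_0 [simp]: "c \<in> carrier G \<Longrightarrow> conj_pow G a c 0 j = c [^] j"
  by (simp add: conj_pow_def)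

lemma int_pow_cancel: "a \<in> carrier G \<Longrightarrow> a [^] (- k) \<otimes> a [^] k = \<one>" for k :: int
  by (simp add: int_pow_neg)

lemma int_pow_cancel': "a \<in> carrier G \<Longrightarrow> a [^] k \<otimes> a [^] (- k) = \<one>" for k :: int
  by (simp add: int_pow_neg)

lemma conj_pow_mult:
  assumes "a \<in> carrier G" "c \<in> carrier G"
  shows "conj_pow G a c k i \<otimes> conj_pow G a c k j = conj_pow G a c k (i + j)"
proof -
  have "conj_pow G a c k i \<otimes> conj_pow G a c k j
      = (a [^] k \<otimes> c [^] i) \<otimes> a [^] (- k) \<otimes> (a [^] k \<otimes> (c [^] j \<otimes> a [^] (- k)))"
    using assms by (simp add: conj_pow_def m_assoc)
  also have "\<dots> = (a [^] k \<otimes> c [^] i) \<otimes> (c [^] j \<otimes> a [^] (- k))"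
    using assms by (intro cancel_mid) (auto simp: int_pow_cancel)
  also have "\<dots> = conj_pow G a c k (i + j)"
    using assms by (simp add: conj_pow_def m_assoc int_pow_mult)
  finally show ?thesis .
qed

lemma conj_pow_shift:
  assumes "a \<in> carrier G" "c \<in> carrier G"
  shows "a [^] i \<otimes> conj_pow G a c k j \<otimes> a [^] (- i) = conj_pow G a c (i + k) j"
proof -
  have "a [^] (- k + - i) = a [^] (- k) \<otimes> a [^] (- i)"
    using assms by (simp only: int_pow_mult)
  then have "a [^] (- (i + k)) = a [^] (- k) \<otimes> a [^] (- i)" by (simp add: algebra_simps)
  then show ?thesis using assms by (simp only: conj_pow_def) (simp add: m_assoc int_pow_mult)
qed

lemma conj_word_shift:
  assumes "a \<in> carrier G" "c \<in> carrier G"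
  shows "a [^] i \<otimes> conj_word G a c ks = conj_word G a c (map (\<lambda>(k, j). (i + k, j)) ks) \<otimes> a [^] i"
proof (induction ks)
  case Nil
  then show ?case using assms by simp
next
  case (Cons p ks)
  obtain k j where p: "p = (k, j)" by force
  have "a [^] i \<otimes> conj_pow G a c k j = conj_pow G a c (i + k) j \<otimes> a [^] i"
    using assms by (simp flip: conj_pow_shift add: m_assoc int_pow_cancel)
  then have "a [^] i \<otimes> conj_word G a c (p # ks)
      = conj_pow G a c (i + k) j \<otimes> (a [^] i \<otimes> conj_word G a c ks)"
    using assms by (simp add: p flip: m_assoc)
  then show ?case using assms by (simp add: Cons p m_assoc)
qed

text \<open>Multiplying by one more syllable merges it with the first one if the indices agree, so reduced
  words represent everything that the conjugates generate, and no new indices appear.\<close>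

lemma conj_word_push:
  assumes "a \<in> carrier G" "c \<in> carrier G" "reduced ks"
  obtains ks' where "reduced ks'" "fst ` set ks' \<subseteq> insert k (fst ` set ks)"
    "conj_word G a c ks' = conj_pow G a c k j \<otimes> conj_word G a c ks"
proof (cases "j = 0")
  case True
  then show ?thesis using that[of ks] assms by auto
next
  case False
  show ?thesis
  proof (cases "ks = [] \<or> fst (hd ks) \<noteq> k")
    case True
    then show ?thesis using that[of "(k, j) # ks"] assms False by (auto simp: reduced_Cons)
  next
    case merge: False
    then obtain i r where ks: "ks = (k, i) # r" by (cases ks) auto
    have *: "conj_pow G a c k j \<otimes> conj_word G a c ks = conj_pow G a c k (j + i) \<otimes> conj_word G a c r"
      using assms by (simp add: ks flip: m_assoc conj_pow_mult)
    show ?thesis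
    proof (cases "j + i = 0")
      case True
      then show ?thesis using that[of r] assms * by (auto simp: ks reduced_Cons)
    next
      case False
      then show ?thesis
        using that[of "(k, j + i) # r"] assms * by (auto simp: ks reduced_Cons)
    qed
  qed
qed

lemma subgroup_centralizer:
  assumes "y \<in> carrier G"
  shows "subgroup {z \<in> carrier G. z \<otimes> y = y \<otimes> z} G"
  using assms by (intro subgroupI) (auto simp: m_assoc inv_solve_left inv_solve_right, metis m_assoc)

text \<open>An induction principle: a generated subgroup can be built up by multiplying with generators and
  their inverses on one side only.\<close>

lemma generate_subset_of_left_closed:
  assumes S: "S \<subseteq> carrier G" and T: "\<one> \<in> T" "T \<subseteq> carrier G"
    and left: "\<And>s t. s \<in> S \<Longrightarrow> t \<in> T \<Longrightarrow> s \<otimes> t \<in> T \<and> inv s \<otimes> t \<in> T"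
  shows "generate G S \<subseteq> T"
proof
  fix x assume x: "x \<in> generate G S"
  have "x \<otimes> t \<in> T" if "t \<in> T" for t
    using x that
  proof (induction arbitrary: t rule: generate.induct)
    case one
    then show ?case using T by (simp add: subsetD)
  next
    case (eng h1 h2)
    have "h1 \<otimes> h2 \<otimes> t = h1 \<otimes> (h2 \<otimes> t)"
      by (intro m_assoc generate_in_carrier[OF S] eng subsetD[OF T(2)])
    with eng show ?case by simp
  qed (simp_all add: left)
  from this[OF T(1)] show "x \<in> T" using generate_in_carrier[OF S x] by simp
qed

lemma conj_pow_in_generate:
  assumes "a \<in> carrier G" "c \<in> carrier G" "k \<in> J"
  shows "conj_pow G a c k j \<in> generate G ((\<lambda>k. conj_pow G a c k 1) ` J)"
proof -
  have sub: "subgroup (generate G ((\<lambda>k. conj_pow G a c k 1) ` J)) G"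
    using assms by (intro generate_is_subgroup) auto
  have "conj_pow G a c k 1 [^] j = conj_pow G a c k j"
  proof -
    interpret h: group_hom integer_group G "conj_pow G a c k"
      using assms is_group
      by (auto simp: group_hom_def group_hom_axioms_def hom_def conj_pow_mult)
    show ?thesis using h.hom_int_pow[of 1 j] by simp
  qed
  moreover have "conj_pow G a c k 1 \<in> generate G ((\<lambda>k. conj_pow G a c k 1) ` J)"
    using assms by (auto intro: generate.incl)
  ultimately show ?thesis using subgroup_int_pow_closed[OF sub] by metis
qed

lemma conj_word_in_generate:
  assumes "a \<in> carrier G" "c \<in> carrier G" "fst ` set ks \<subseteq> J"
  shows "conj_word G a c ks \<in> generate G ((\<lambda>k. conj_pow G a c k 1) ` J)"
  using assms(3)
proof (induction ks)
  case (Cons p ks)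
  then show ?case
    using conj_pow_in_generate[OF assms(1,2)] by (cases p) (auto intro: generate.eng)
qed (auto intro: generate.one)

lemma generate_conjugates:
  assumes "a \<in> carrier G" "c \<in> carrier G"
    and "x \<in> generate G ((\<lambda>k. conj_pow G a c k 1) ` J)"
  obtains ks where "reduced ks" "fst ` set ks \<subseteq> J" "x = conj_word G a c ks"
proof -
  define T where "T = {conj_word G a c ks |ks. reduced ks \<and> fst ` set ks \<subseteq> J}"
  have "generate G ((\<lambda>k. conj_pow G a c k 1) ` J) \<subseteq> T"
  proof (rule generate_subset_of_left_closed)
    show "\<one> \<in> T" unfolding T_def by (auto intro!: exI[of _ "[]"])
  next
    fix s t assume "s \<in> (\<lambda>k. conj_pow G a c k 1) ` J" "t \<in> T"
    then obtain k ks where k: "k \<in> J" "s = conj_pow G a c k 1"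
      and ks: "reduced ks" "fst ` set ks \<subseteq> J" "t = conj_word G a c ks"
      unfolding T_def by auto
    have inv: "inv s = conj_pow G a c k (- 1)"
      by (rule inv_equality) (use assms k in \<open>auto simp: conj_pow_mult\<close>)
    have "conj_pow G a c k j \<otimes> t \<in> T" for j
      using conj_word_push[OF assms(1,2) ks(1), of k j] ks(2,3) k(1) unfolding T_def
      by (smt (verit) insert_absorb insert_subset mem_Collect_eq subset_insertI2 subset_trans)
    then show "s \<otimes> t \<in> T \<and> inv s \<otimes> t \<in> T" using k inv by simp
  qed (use assms in \<open>auto simp: T_def\<close>)
  with assms(3) obtain ks where "x = conj_word G a c ks" "reduced ks" "fst ` set ks \<subseteq> J"
    unfolding T_def by blast
  with that show thesis by blast
qed

text \<open>Finitely many elements involve only finitely many of the indices \<open>k\<close>, and by freeness a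
  conjugate with a new index is not a product of those with old ones.\<close>

lemma free_conjugates_not_fin_gen:
  assumes "a \<in> carrier G" "c \<in> carrier G" "free_conjugates G a c"
    and "finite F" "F \<subseteq> generate G (range (\<lambda>k. conj_pow G a c k 1))"
  shows "generate G F \<noteq> generate G (range (\<lambda>k. conj_pow G a c k 1))"
proof -
  let ?b = "\<lambda>k. conj_pow G a c k 1"
  have "\<forall>x\<in>F. \<exists>ks. x = conj_word G a c ks"
    using assms(5) generate_conjugates[OF assms(1,2), of _ UNIV] by (metis subsetD)
  then obtain w where w: "\<And>x. x \<in> F \<Longrightarrow> x = conj_word G a c (w x)" by metis
  define J where "J = (\<Union>x\<in>F. fst ` set (w x))"
  have "finite J" using assms(4) by (simp add: J_def)
  then obtain m where m: "m \<notin> J" using ex_new_if_finite infinite_UNIV_int by blast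
  have "F \<subseteq> generate G (?b ` J)"
  proof
    fix x assume "x \<in> F"
    then have "conj_word G a c (w x) \<in> generate G (?b ` J)"
      by (intro conj_word_in_generate assms) (auto simp: J_def)
    then show "x \<in> generate G (?b ` J)" using w[OF \<open>x \<in> F\<close>] by simp
  qed
  then have gF: "generate G F \<subseteq> generate G (?b ` J)"
    using assms by (intro generate_subgroup_incl generate_is_subgroup) auto
  have "?b m \<notin> generate G (?b ` J)"
  proof
    assume "?b m \<in> generate G (?b ` J)"
    then obtain ks where ks: "reduced ks" "fst ` set ks \<subseteq> J" "?b m = conj_word G a c ks"
      using generate_conjugates[OF assms(1,2)] by metis
    have "reduced ((m, - 1) # ks)"
      using ks m by (cases ks) (auto simp: reduced_Cons)
    moreover have "conj_word G a c ((m, - 1) # ks) = \<one>"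
      using assms(1,2) by (simp add: conj_pow_mult flip: ks(3))
    ultimately show False using assms(3) unfolding free_conjugates_def by blast
  qed
  moreover have "?b m \<in> generate G (range ?b)" by (auto intro: generate.incl)
  ultimately show ?thesis using gF by blast
qed

text \<open>Normal form in a group generated by \<open>a\<close>, \<open>c\<close> and a subgroup \<open>P\<close> that \<open>c\<close> centralizes and \<open>a\<close>
  normalizes: factors from \<open>P\<close> move to the left, and powers of \<open>a\<close> move to the right by conjugating the
  letters \<open>c\<close> that they pass.\<close>

lemma conj_word_normal_form:
  assumes P: "subgroup P G" and ac: "a \<in> carrier G" "c \<in> carrier G"
    and Pc: "\<And>p. p \<in> P \<Longrightarrow> c \<otimes> p = p \<otimes> c"
    and Pa: "\<And>p i. p \<in> P \<Longrightarrow> a [^] (i :: int) \<otimes> p \<otimes> a [^] (- i) \<in> P"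
    and x: "x \<in> generate G (P \<union> {a, c})"
  obtains p ks e where "p \<in> P" "reduced ks" "x = p \<otimes> (conj_word G a c ks \<otimes> a [^] (e :: int))"
proof -
  define T where "T = {p \<otimes> (conj_word G a c ks \<otimes> a [^] e) |p ks e :: int. p \<in> P \<and> reduced ks}"
  have TI: "p \<otimes> (conj_word G a c ks \<otimes> a [^] e) \<in> T" if "p \<in> P" "reduced ks" for p ks and e :: int
    unfolding T_def using that by (intro CollectI exI conjI) (rule refl)
  have PG: "p \<in> carrier G" if "p \<in> P" for p by (rule subgroup.mem_carrier[OF P that])
  have TP: "q \<otimes> t \<in> T" if "q \<in> P" "t \<in> T" for q t
  proof -
    obtain p ks e where t: "t = p \<otimes> (conj_word G a c ks \<otimes> a [^] (e :: int))" "p \<in> P" "reduced ks"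
      using \<open>t \<in> T\<close> unfolding T_def by blast
    have "q \<otimes> t = (q \<otimes> p) \<otimes> (conj_word G a c ks \<otimes> a [^] e)"
      using that t PG ac by (simp add: m_assoc)
    then show ?thesis using TI[OF subgroup.m_closed[OF P that(1) t(2)] t(3)] by simp
  qed
  have Ta: "a [^] i \<otimes> t \<in> T" if "t \<in> T" for t and i :: int
  proof -
    obtain p ks e where t: "t = p \<otimes> (conj_word G a c ks \<otimes> a [^] (e :: int))" "p \<in> P" "reduced ks"
      using \<open>t \<in> T\<close> unfolding T_def by blast
    let ?p = "a [^] i \<otimes> p \<otimes> a [^] (- i)" and ?ks = "map (\<lambda>(k, j). (i + k, j)) ks"
    have "a [^] i \<otimes> p = ?p \<otimes> a [^] i"
      using t PG ac by (simp add: m_assoc int_pow_cancel)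
    then have "a [^] i \<otimes> t = ?p \<otimes> (a [^] i \<otimes> conj_word G a c ks \<otimes> a [^] e)"
      using t PG ac by (simp add: m_assoc[symmetric])
    also have "\<dots> = ?p \<otimes> (conj_word G a c ?ks \<otimes> (a [^] i \<otimes> a [^] e))"
      using ac t PG by (simp only: conj_word_shift) (simp add: m_assoc)
    also have "\<dots> = ?p \<otimes> (conj_word G a c ?ks \<otimes> a [^] (i + e))"
      using ac by (simp add: int_pow_mult)
    finally show ?thesis using TI[OF Pa[OF t(2)] reduced_shift[OF t(3)]] by simp
  qed
  have Tc: "c [^] j \<otimes> t \<in> T" if "t \<in> T" for t and j :: int
  proof -
    obtain p ks e where t: "t = p \<otimes> (conj_word G a c ks \<otimes> a [^] (e :: int))" "p \<in> P" "reduced ks"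
      using \<open>t \<in> T\<close> unfolding T_def by blast
    have "c [^] j \<otimes> p = p \<otimes> c [^] j"
      using subgroup_int_pow_closed[OF subgroup_centralizer[OF PG[OF t(2)]], of c j] ac Pc[OF t(2)]
      by blast
    then have *: "c [^] j \<otimes> t = p \<otimes> (conj_pow G a c 0 j \<otimes> conj_word G a c ks \<otimes> a [^] e)"
      using t PG ac by (simp add: m_assoc[symmetric])
    obtain ks' where "reduced ks'" "conj_word G a c ks' = conj_pow G a c 0 j \<otimes> conj_word G a c ks"
      using conj_word_push[OF ac t(3), of 0 j] by metis
    then show ?thesis using TI[OF t(2), of ks' e] by (simp add: *)
  qed
  have "generate G (P \<union> {a, c}) \<subseteq> T"
  proof (rule generate_subset_of_left_closed)
    show "\<one> \<in> T"
      using TI[OF subgroup.one_closed[OF P] reduced_Nil, of 0] by simp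
  next
    fix s t assume "s \<in> P \<union> {a, c}" "t \<in> T"
    moreover have "inv a = a [^] (- 1 :: int)" "inv c = c [^] (- 1 :: int)"
      using ac by (simp_all add: int_pow_neg)
    ultimately show "s \<otimes> t \<in> T \<and> inv s \<otimes> t \<in> T"
      using TP Ta[of t 1] Ta[of t "- 1"] Tc[of t 1] Tc[of t "- 1"] ac subgroup.m_inv_closed[OF P]
      by auto
  qed (use PG ac in \<open>auto simp: T_def\<close>)
  with x obtain p ks e where "x = p \<otimes> (conj_word G a c ks \<otimes> a [^] (e :: int))"
    "p \<in> P" "reduced ks"
    unfolding T_def by blast
  with that show thesis by blast
qed

end

lemma hom_conj_word:
  assumes "group G" "group L" "f \<in> hom G L" "a \<in> carrier G" "c \<in> carrier G"
  shows "f (conj_word G a c ks) = conj_word L (f a) (f c) ks"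
proof (induction ks)
  case Nil
  then show ?case using hom_one[OF assms(3,1,2)] by simp
next
  case (Cons p ks)
  then show ?case
    using assms by (cases p) (simp add: hom_mult[OF assms(3)] hom_conj_pow
      group.conj_pow_closed group.conj_word_closed)
qed

section \<open>Normal closures\<close>

lemma normal_closure_superset: "S \<subseteq> normal_closure G S"
  unfolding normal_closure_def by blast

lemma normal_closure_minimal: "N \<lhd> G \<Longrightarrow> S \<subseteq> N \<Longrightarrow> normal_closure G S \<subseteq> N"
  unfolding normal_closure_def by blast

lemma normal_closure_mono: "S \<subseteq> T \<Longrightarrow> normal_closure G S \<subseteq> normal_closure G T"
  unfolding normal_closure_def by blast

context group begin

lemma normal_closure_normal:
  assumes "S \<subseteq> carrier G"
  shows "normal_closure G S \<lhd> G"
proof -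
  have "subgroup (normal_closure G S) G"
    unfolding normal_closure_def
    using assms normal_self by (intro subgroups_Inter) (auto dest: normal_imp_subgroup)
  moreover have "x \<otimes> h \<otimes> inv x \<in> normal_closure G S"
    if "x \<in> carrier G" "h \<in> normal_closure G S" for x h
    using that unfolding normal_closure_def by (auto dest: normal.inv_op_closed2)
  ultimately show ?thesis by (simp add: normal_inv_iff)
qed

text \<open>The normal closures of the finite subsets of \<open>S\<close> form a directed family, so their union is
  already a normal subgroup.\<close>

lemma normal_closure_finite_support:
  assumes S: "S \<subseteq> carrier G" and w: "w \<in> normal_closure G S"
  obtains F where "finite F" "F \<subseteq> S" "w \<in> normal_closure G F"
proof -
  define N where "N = (\<Union>F\<in>{F. finite F \<and> F \<subseteq> S}. normal_closure G F)"
  have NI: "x \<in> N" if "finite F" "F \<subseteq> S" "x \<in> normal_closure G F" for F x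
    unfolding N_def using that by (intro UN_I[of F]) simp_all
  have NE: "\<exists>F. finite F \<and> F \<subseteq> S \<and> F \<subseteq> carrier G \<and> x \<in> normal_closure G F" if x: "x \<in> N" for x
  proof -
    obtain F where "finite F" "F \<subseteq> S" "x \<in> normal_closure G F"
      using x unfolding N_def by auto
    with S show ?thesis by (intro exI[of _ F]) auto
  qed
  have sub: "subgroup (normal_closure G F) G" if "F \<subseteq> carrier G" for F
    by (rule normal_imp_subgroup[OF normal_closure_normal[OF that]])
  have "subgroup N G"
  proof (rule subgroupI)
    show "N \<subseteq> carrier G"
    proof
      fix x assume "x \<in> N"
      from NE[OF this] obtain F where "F \<subseteq> carrier G" "x \<in> normal_closure G F" by auto
      then show "x \<in> carrier G" using subgroup.mem_carrier[OF sub] by simp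
    qed
    show "N \<noteq> {}" using NI[OF _ _ subgroup.one_closed[OF sub], of "{}"] by auto
  next
    fix x assume "x \<in> N"
    from NE[OF this] obtain F where F: "finite F" "F \<subseteq> S" "F \<subseteq> carrier G"
      "x \<in> normal_closure G F"
      by auto
    then have "inv x \<in> normal_closure G F"
      by (intro subgroup.m_inv_closed[OF sub])
    with F show "inv x \<in> N" by (intro NI)
  next
    fix x y assume xy: "x \<in> N" "y \<in> N"
    from NE[OF xy(1)] NE[OF xy(2)] obtain E F where EF: "finite E" "E \<subseteq> S" "E \<subseteq> carrier G" "x \<in> normal_closure G E"
      "finite F" "F \<subseteq> S" "F \<subseteq> carrier G" "y \<in> normal_closure G F"
      by auto
    then have "x \<in> normal_closure G (E \<union> F)" "y \<in> normal_closure G (E \<union> F)"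
      using normal_closure_mono[of E "E \<union> F" G] normal_closure_mono[of F "E \<union> F" G] by auto
    moreover have "subgroup (normal_closure G (E \<union> F)) G" using EF by (intro sub) simp
    ultimately have "x \<otimes> y \<in> normal_closure G (E \<union> F)"
      by (intro subgroup.m_closed)
    then show "x \<otimes> y \<in> N" using EF by (intro NI[of "E \<union> F"]) auto
  qed
  moreover have "x \<otimes> h \<otimes> inv x \<in> N" if x: "x \<in> carrier G" and h: "h \<in> N" for x h
  proof -
    obtain F where F: "finite F" "F \<subseteq> S" "F \<subseteq> carrier G" "h \<in> normal_closure G F"
      using NE[OF h] by auto
    show ?thesis
      by (rule NI[OF F(1,2) normal.inv_op_closed2[OF normal_closure_normal[OF F(3)] x F(4)]])
  qed
  ultimately have "N \<lhd> G" by (simp add: normal_inv_iff)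
  moreover have "S \<subseteq> N"
  proof
    fix s assume "s \<in> S"
    then show "s \<in> N" using NI[of "{s}" s] normal_closure_superset[of "{s}" G] by simp
  qed
  ultimately have "normal_closure G S \<subseteq> N" by (rule normal_closure_minimal)
  with w have "w \<in> N" ..
  from NE[OF this] that show thesis by auto
qed

end

section \<open>Constants and variable in the free product\<close>

definition const_word :: "('a, 'x) monoid_scheme \<Rightarrow> 'a set \<Rightarrow> 'a \<Rightarrow> ('a + int) list set" where
  "const_word G H h = fp_rel (G\<lparr>carrier := H\<rparr>) integer_group `` {[Inl h]}"

text \<open>The infinite cyclic group is written additively, so its generator is the letter \<open>1\<close>.\<close>

definition var_word :: "('a, 'x) monoid_scheme \<Rightarrow> 'a set \<Rightarrow> ('a + int) list set" where
  "var_word G H = fp_rel (G\<lparr>carrier := H\<rparr>) integer_group `` {[Inr 1]}"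

locale subgroup_equations = G: group G + H: subgroup H G
  for G (structure) and H
begin

abbreviation E where "E \<equiv> adjoin_var G H"
abbreviation GH where "GH \<equiv> G\<lparr>carrier := H\<rparr>"

lemma group_GH: "group GH"
  by (rule H.subgroup_is_group) (rule G.is_group)

lemma group_Z: "group integer_group"
  by simp

sublocale E: group E
  by (intro group_adjoin_var G.is_group H.subgroup_axioms)

lemma word_in_carrier:
  "u \<in> fp_words GH integer_group \<Longrightarrow> fp_rel GH integer_group `` {u} \<in> carrier E"
  unfolding adjoin_var_def by (rule fp_class_in_carrier)

lemma word_append:
  assumes "u \<in> fp_words GH integer_group" "v \<in> fp_words GH integer_group"
  shows "fp_rel GH integer_group `` {u @ v}
    = fp_rel GH integer_group `` {u} \<otimes>\<^bsub>E\<^esub> fp_rel GH integer_group `` {v}"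
  unfolding adjoin_var_def by (rule fp_mult_class[OF group_GH group_Z assms, symmetric])

lemma word_eqI:
  "fp_cong GH integer_group u v
    \<Longrightarrow> fp_rel GH integer_group `` {u} = fp_rel GH integer_group `` {v}"
  by (rule fp_class_eqI[OF group_GH group_Z])

lemma const_word_hom: "const_word G H \<in> hom GH E"
proof (rule homI)
  show "const_word G H h \<in> carrier E" if "h \<in> carrier GH" for h
    using that unfolding const_word_def by (intro word_in_carrier) (auto simp: fp_words_def)
  show "const_word G H (h \<otimes>\<^bsub>GH\<^esub> k) = const_word G H h \<otimes>\<^bsub>E\<^esub> const_word G H k"
    if "h \<in> carrier GH" "k \<in> carrier GH" for h k
  proof -
    have "const_word G H h \<otimes>\<^bsub>E\<^esub> const_word G H k = fp_rel GH integer_group `` {[Inl h] @ [Inl k]}"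
      unfolding const_word_def using that by (intro word_append[symmetric]) (auto simp: fp_words_def)
    also have "\<dots> = const_word G H (h \<otimes>\<^bsub>GH\<^esub> k)"
      unfolding const_word_def using fp_mult_left[OF that, of integer_group] by (intro word_eqI) simp
    finally show ?thesis by simp
  qed
qed

lemma power_word_hom: "(\<lambda>k. fp_rel GH integer_group `` {[Inr k]}) \<in> hom integer_group E"
proof (rule homI)
  show "fp_rel GH integer_group `` {[Inr k]} \<in> carrier E" for k
    by (intro word_in_carrier) (auto simp: fp_words_def)
  show "fp_rel GH integer_group `` {[Inr (i \<otimes>\<^bsub>integer_group\<^esub> j)]}
    = fp_rel GH integer_group `` {[Inr i]} \<otimes>\<^bsub>E\<^esub> fp_rel GH integer_group `` {[Inr j]}" for i j
  proof -
    have "fp_rel GH integer_group `` {[Inr i]} \<otimes>\<^bsub>E\<^esub> fp_rel GH integer_group `` {[Inr j]}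
        = fp_rel GH integer_group `` {[Inr i] @ [Inr j]}"
      by (intro word_append[symmetric]) (auto simp: fp_words_def)
    also have "\<dots> = fp_rel GH integer_group `` {[Inr (i \<otimes>\<^bsub>integer_group\<^esub> j)]}"
      using fp_mult_right[of i integer_group j GH] by (intro word_eqI) simp
    finally show ?thesis by simp
  qed
qed

lemma const_word_closed [simp]: "h \<in> H \<Longrightarrow> const_word G H h \<in> carrier E"
  using hom_in_carrier[OF const_word_hom] by simp

lemma const_word_mult:
  "h \<in> H \<Longrightarrow> k \<in> H \<Longrightarrow> const_word G H (h \<otimes> k) = const_word G H h \<otimes>\<^bsub>E\<^esub> const_word G H k"
  using hom_mult[OF const_word_hom] by simp

lemma const_word_one [simp]: "const_word G H \<one> = \<one>\<^bsub>E\<^esub>"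
  using hom_one[OF const_word_hom group_GH E.is_group] by simp

lemma const_word_int_pow:
  assumes "h \<in> H"
  shows "const_word G H (h [^] (k :: int)) = const_word G H h [^]\<^bsub>E\<^esub> k"
proof -
  interpret c: group_hom GH E "const_word G H"
    using const_word_hom group_GH by (simp add: group_hom_def group_hom_axioms_def E.is_group)
  show ?thesis
    using c.hom_int_pow[of h k] assms G.int_pow_consistent[OF H.subgroup_axioms assms] by simp
qed

lemma var_word_closed [simp]: "var_word G H \<in> carrier E"
  using hom_in_carrier[OF power_word_hom, of 1] by (simp add: var_word_def)

lemma power_word: "fp_rel GH integer_group `` {[Inr k]} = var_word G H [^]\<^bsub>E\<^esub> (k :: int)"
proof -
  interpret c: group_hom integer_group E "\<lambda>k. fp_rel GH integer_group `` {[Inr k]}"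
    using power_word_hom by (simp add: group_hom_def group_hom_axioms_def E.is_group)
  show ?thesis using c.hom_int_pow[of 1 k] by (simp add: var_word_def)
qed

lemma carrier_generated: "carrier E \<subseteq> generate E (const_word G H ` H \<union> {var_word G H})"
proof
  let ?S = "const_word G H ` H \<union> {var_word G H}"
  have S: "?S \<subseteq> carrier E" by auto
  fix w assume "w \<in> carrier E"
  then obtain u where u: "u \<in> fp_words GH integer_group" "w = fp_rel GH integer_group `` {u}"
    unfolding adjoin_var_def by (rule fp_carrierE)
  have "u \<in> lists (Inl ` carrier GH \<union> Inr ` carrier integer_group)"
    using u(1) by (simp add: fp_words_def)
  then have "fp_rel GH integer_group `` {u} \<in> generate E ?S"
  proof (induction u rule: lists.induct)
    case Nil
    have "fp_rel GH integer_group `` {[]} = \<one>\<^bsub>E\<^esub>"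
      by (simp add: adjoin_var_def free_product_def)
    then show ?case by (simp add: generate.one)
  next
    case (Cons l u)
    have l: "fp_rel GH integer_group `` {[l]} \<in> generate E ?S"
    proof (cases l)
      case (Inl h)
      then have "h \<in> H" using Cons(1) by auto
      then show ?thesis using Inl by (auto simp flip: const_word_def intro: generate.incl)
    next
      case (Inr k)
      have "var_word G H \<in> generate E ?S" by (auto intro: generate.incl)
      then show ?thesis
        using Inr E.subgroup_int_pow_closed[OF E.generate_is_subgroup[OF S]] by (simp add: power_word)
    qed
    have "fp_rel GH integer_group `` {[l] @ u}
        = fp_rel GH integer_group `` {[l]} \<otimes>\<^bsub>E\<^esub> fp_rel GH integer_group `` {u}"
      using Cons by (intro word_append) (auto simp: fp_words_def)
    with l Cons show ?case by (simp add: generate.eng)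
  qed
  with u show "w \<in> generate E ?S" by simp
qed

lemma universal_property:
  assumes "group L" "\<phi> \<in> hom GH L" "s \<in> carrier L"
  shows "fp_lift L \<phi> (\<lambda>k :: int. s [^]\<^bsub>L\<^esub> k) \<in> hom E L"
    and "h \<in> H \<Longrightarrow> fp_lift L \<phi> (\<lambda>k :: int. s [^]\<^bsub>L\<^esub> k) (const_word G H h) = \<phi> h"
    and "fp_lift L \<phi> (\<lambda>k :: int. s [^]\<^bsub>L\<^esub> k) (var_word G H) = s"
proof -
  interpret L: group L by fact
  have pow: "(\<lambda>k :: int. s [^]\<^bsub>L\<^esub> k) \<in> hom integer_group L"
    using L.hom_integer_group_pow[OF assms(3)] by simp
  show "fp_lift L \<phi> (\<lambda>k :: int. s [^]\<^bsub>L\<^esub> k) \<in> hom E L"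
    unfolding adjoin_var_def by (rule fp_lift_hom[OF group_GH group_Z assms(1,2) pow])
  show "fp_lift L \<phi> (\<lambda>k :: int. s [^]\<^bsub>L\<^esub> k) (const_word G H h) = \<phi> h" if "h \<in> H"
    unfolding const_word_def using that hom_in_carrier[OF assms(2), of h]
    by (subst fp_lift_class[OF group_GH group_Z assms(1,2) pow])
      (auto simp: fp_words_def fp_word_eval_def)
  show "fp_lift L \<phi> (\<lambda>k :: int. s [^]\<^bsub>L\<^esub> k) (var_word G H) = s"
    unfolding var_word_def using assms(3)
    by (subst fp_lift_class[OF group_GH group_Z assms(1,2) pow])
      (auto simp: fp_words_def fp_word_eval_def)
qed

lemma eval_const_word: "g \<in> carrier G \<Longrightarrow> h \<in> H \<Longrightarrow> eval_at G g (const_word G H h) = h"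
  and eval_var_word: "g \<in> carrier G \<Longrightarrow> eval_at G g (var_word G H) = g"
proof -
  have "(\<lambda>h. h) \<in> hom GH G" by (rule homI) auto
  note lift = universal_property(2,3)[OF G.is_group this]
  show "g \<in> carrier G \<Longrightarrow> h \<in> H \<Longrightarrow> eval_at G g (const_word G H h) = h"
    and "g \<in> carrier G \<Longrightarrow> eval_at G g (var_word G H) = g"
    unfolding eval_at_def by (simp_all add: lift)
qed

text \<open>The commutator of \<open>x\<close> and \<open>u\<close>, bracketed as \<open>x u (u x)\<^sup>-\<^sup>1\<close> so that it is killed exactly when
  \<open>x u\<close> and \<open>u x\<close> have the same image.\<close>

definition var_commutator :: "'a \<Rightarrow> ('a + int) list set" where
  "var_commutator u = var_word G H \<otimes>\<^bsub>E\<^esub> const_word G H u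
    \<otimes>\<^bsub>E\<^esub> inv\<^bsub>E\<^esub> (const_word G H u \<otimes>\<^bsub>E\<^esub> var_word G H)"

lemma var_commutator_closed [simp]: "u \<in> H \<Longrightarrow> var_commutator u \<in> carrier E"
  by (simp add: var_commutator_def)

lemma var_commutator_in_kernel_iff:
  assumes "group L" "f \<in> hom E L" "u \<in> H"
  shows "var_commutator u \<in> kernel E L f \<longleftrightarrow>
    f (var_word G H) \<otimes>\<^bsub>L\<^esub> f (const_word G H u) = f (const_word G H u) \<otimes>\<^bsub>L\<^esub> f (var_word G H)"
proof -
  interpret L: group L by fact
  interpret f: group_hom E L f
    using assms by (simp add: group_hom_def group_hom_axioms_def E.is_group)
  have "f (var_commutator u) = f (var_word G H) \<otimes>\<^bsub>L\<^esub> f (const_word G H u)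
      \<otimes>\<^bsub>L\<^esub> inv\<^bsub>L\<^esub> (f (const_word G H u) \<otimes>\<^bsub>L\<^esub> f (var_word G H))"
    using assms(3) by (simp add: var_commutator_def)
  then show ?thesis
    using assms(3) L.inv_solve_right'[of "\<one>\<^bsub>L\<^esub>"] by (auto simp: kernel_def L.inv_solve_right')
qed

end

section \<open>Subgroups as centralizers\<close>

lemma BijGroup_UNIV:
  "carrier (BijGroup UNIV) = {f. bij f}"
  "f \<in> carrier (BijGroup UNIV) \<Longrightarrow> f' \<in> carrier (BijGroup UNIV)
    \<Longrightarrow> f \<otimes>\<^bsub>BijGroup UNIV\<^esub> f' = f \<circ> f'"
  by (auto simp: BijGroup_def Bij_def compose_def)

text \<open>Let \<open>G\<close> act by left translation on two copies of its power set, and let \<open>s\<close> exchange the two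
  copies of the point \<open>V\<close> and fix everything else.  A translation commutes with \<open>s\<close> if and only if it fixes
  the point \<open>V\<close>, and the stabilizer of \<open>V\<close> is \<open>V\<close>.\<close>

lemma (in group) subgroup_is_centralizer:
  assumes V: "subgroup V G"
  obtains \<rho> and s :: "'a set \<times> bool \<Rightarrow> 'a set \<times> bool"
  where "\<rho> \<in> hom G (BijGroup UNIV)" "s \<in> carrier (BijGroup UNIV)"
    "\<And>h. h \<in> carrier G \<Longrightarrow>
      s \<otimes>\<^bsub>BijGroup UNIV\<^esub> \<rho> h = \<rho> h \<otimes>\<^bsub>BijGroup UNIV\<^esub> s \<longleftrightarrow> h \<in> V"
proof -
  \<comment> \<open>The action is extended by the identity outside the carrier, so that it is by bijections of
    the whole type.\<close>
  define act where "act h x = (if x \<in> carrier G then h \<otimes> x else x)" for h x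
  define \<rho> :: "'a \<Rightarrow> 'a set \<times> bool \<Rightarrow> 'a set \<times> bool"
    where "\<rho> h = (\<lambda>(S, i). (act h ` S, i))" for h
  define s :: "'a set \<times> bool \<Rightarrow> 'a set \<times> bool"
    where "s = (\<lambda>(S, i). (S, if S = V then \<not> i else i))"
  have act_mult: "act (h \<otimes> k) = act h \<circ> act k" if "h \<in> carrier G" "k \<in> carrier G" for h k
    using that by (auto simp: act_def m_assoc)
  have \<rho>_mult: "\<rho> (h \<otimes> k) = \<rho> h \<circ> \<rho> k" if "h \<in> carrier G" "k \<in> carrier G" for h k
    using act_mult[OF that] by (auto simp: \<rho>_def image_comp)
  have act_one: "act \<one> = id" by (auto simp: act_def)
  have "\<rho> \<one> = id" by (auto simp: \<rho>_def act_one)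
  then have \<rho>_inv: "\<rho> h \<circ> \<rho> (inv h) = id" "\<rho> (inv h) \<circ> \<rho> h = id" if "h \<in> carrier G" for h
    using that by (simp_all flip: \<rho>_mult)
  have bij: "bij (\<rho> h)" if "h \<in> carrier G" for h
    using \<rho>_inv[OF that] by (rule o_bij[rotated])
  have "s \<circ> s = id" by (auto simp: s_def)
  then have s: "bij s" using o_bij by blast
  have "\<rho> \<in> hom G (BijGroup UNIV)"
    using bij by (auto simp: hom_def BijGroup_UNIV \<rho>_mult)
  moreover have "s \<circ> \<rho> h = \<rho> h \<circ> s \<longleftrightarrow> h \<in> V" if h: "h \<in> carrier G" for h
  proof
    assume h': "h \<in> V"
    have V_sub: "V \<subseteq> carrier G" by (rule subgroup.subset[OF V])
    have "act k ` V \<subseteq> V" if "k \<in> V" for k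
      using that V_sub subgroup.m_closed[OF V] by (auto simp: act_def)
    then have sub: "act h ` V \<subseteq> V" "act (inv h) ` V \<subseteq> V"
      using h' subgroup.m_inv_closed[OF V] by blast+
    have inv: "act h ` act (inv h) ` S = S" "act (inv h) ` act h ` S = S" for S
      using h by (simp_all add: image_comp act_one flip: act_mult)
    have "act h ` S = V \<longleftrightarrow> S = V" for S
      using sub inv by (metis image_mono subset_antisym)
    then show "s \<circ> \<rho> h = \<rho> h \<circ> s" by (auto simp: s_def \<rho>_def)
  next
    assume eq: "s \<circ> \<rho> h = \<rho> h \<circ> s"
    have "act h ` V = V"
      using fun_cong[OF eq, of "(V, True)"] by (simp add: s_def \<rho>_def split: if_splits)
    moreover have "\<one> \<in> V" by (rule subgroup.one_closed[OF V])
    ultimately have "act h \<one> \<in> V" by blast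
    then show "h \<in> V" using h by (simp add: act_def)
  qed
  ultimately show thesis using that[of \<rho> s] s bij by (simp add: BijGroup_UNIV)
qed

section \<open>Ideals generated by infinitely many commutators\<close>

context subgroup_equations begin

text \<open>Send \<open>x\<close> to an element whose centralizer in \<open>H\<close> is the subgroup generated by \<open>F\<close>: this kills the
  commutators with \<open>F\<close>, and of the others only those with elements of that subgroup.\<close>

lemma commutator_in_finite_closure:
  assumes F: "F \<subseteq> H" and u: "u \<in> H" and mem: "var_commutator u \<in> normal_closure E (var_commutator ` F)"
  shows "u \<in> generate G F"
proof -
  have FG: "F \<subseteq> carrier G" using F H.subset by blast
  obtain \<rho> and s :: "'a set \<times> bool \<Rightarrow> 'a set \<times> bool"
    where \<rho>: "\<rho> \<in> hom G (BijGroup UNIV)" and s: "s \<in> carrier (BijGroup UNIV)"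
      and comm: "\<And>h. h \<in> carrier G \<Longrightarrow>
        s \<otimes>\<^bsub>BijGroup UNIV\<^esub> \<rho> h = \<rho> h \<otimes>\<^bsub>BijGroup UNIV\<^esub> s \<longleftrightarrow> h \<in> generate G F"
    using G.subgroup_is_centralizer[OF G.generate_is_subgroup[OF FG]] by blast
  let ?L = "BijGroup (UNIV :: ('a set \<times> bool) set)"
  have L: "group ?L" by (rule group_BijGroup)
  have \<rho>H: "\<rho> \<in> hom GH ?L" using \<rho> H.subset by (auto simp: hom_def)
  define f where "f = fp_lift ?L \<rho> (\<lambda>k :: int. s [^]\<^bsub>?L\<^esub> k)"
  have f: "f \<in> hom E ?L" "f (var_word G H) = s" and fc: "\<And>h. h \<in> H \<Longrightarrow> f (const_word G H h) = \<rho> h"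
    unfolding f_def using universal_property[OF L \<rho>H s] by blast+
  have kernel: "var_commutator h \<in> kernel E ?L f \<longleftrightarrow> h \<in> generate G F" if "h \<in> H" for h
    using that comm[OF H.mem_carrier[OF that]]
    by (simp add: var_commutator_in_kernel_iff[OF L f(1)] f(2) fc)
  have "kernel E ?L f \<lhd> E"
    using L f(1) by (intro group_hom.normal_kernel)
      (simp add: group_hom_def group_hom_axioms_def E.is_group)
  moreover have "var_commutator ` F \<subseteq> kernel E ?L f"
    using F kernel by (auto intro: generate.incl)
  ultimately have "var_commutator u \<in> kernel E ?L f"
    using mem normal_closure_minimal by blast
  with kernel[OF u] show ?thesis by simp
qed

text \<open>A finite normal generating set would be contained in the normal closure of finitely many of the
  commutators \<open>[x, u]\<close>, which contains too few of them because \<open>U\<close> is not finitely generated.\<close>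

lemma equation_ideal_not_fin_gen:
  assumes g: "g \<in> carrier G" and U: "U \<subseteq> H" "\<And>u. u \<in> U \<Longrightarrow> g \<otimes> u = u \<otimes> g"
    and ideal: "equation_ideal G H g \<subseteq> normal_closure E (var_commutator ` U)"
    and not_fg: "\<And>F. finite F \<Longrightarrow> F \<subseteq> U \<Longrightarrow> \<not> U \<subseteq> generate G F"
  shows "\<not> fin_gen_as_normal E (equation_ideal G H g)"
proof
  assume "fin_gen_as_normal E (equation_ideal G H g)"
  then obtain S where S: "finite S" "S \<subseteq> carrier E" "equation_ideal G H g = normal_closure E S"
    unfolding fin_gen_as_normal_def by blast
  have UE: "var_commutator ` U \<subseteq> carrier E" using U(1) by auto
  have "\<exists>F. finite F \<and> F \<subseteq> U \<and> w \<in> normal_closure E (var_commutator ` F)" if "w \<in> S" for w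
  proof -
    have "w \<in> normal_closure E (var_commutator ` U)"
      using subsetD[OF ideal] subsetD[OF normal_closure_superset that, of E] by (simp add: S(3))
    from E.normal_closure_finite_support[OF UE this]
    obtain F where "finite F" "F \<subseteq> var_commutator ` U" "w \<in> normal_closure E F" .
    then show ?thesis by (metis finite_subset_image)
  qed
  then obtain F where F: "\<And>w. w \<in> S \<Longrightarrow> finite (F w) \<and> F w \<subseteq> U \<and>
      w \<in> normal_closure E (var_commutator ` F w)"
    by metis
  define F' where "F' = (\<Union>w\<in>S. F w)"
  have F': "finite F'" "F' \<subseteq> U" using F S(1) by (auto simp: F'_def)
  have F'E: "var_commutator ` F' \<subseteq> carrier E" using UE F'(2) by blast
  have "S \<subseteq> normal_closure E (var_commutator ` F')"
  proof
    fix w assume w: "w \<in> S"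
    then have "var_commutator ` F w \<subseteq> var_commutator ` F'" by (auto simp: F'_def)
    from normal_closure_mono[OF this] F[OF w] show "w \<in> normal_closure E (var_commutator ` F')" by blast
  qed
  then have sub: "equation_ideal G H g \<subseteq> normal_closure E (var_commutator ` F')"
    unfolding S(3) by (intro normal_closure_minimal E.normal_closure_normal F'E)
  have "U \<subseteq> generate G F'"
  proof
    fix u assume u: "u \<in> U"
    then have uH: "u \<in> H" using U(1) by blast
    have "var_commutator u \<in> kernel E G (eval_at G g)"
      using uH U(2)[OF u] g
      by (simp add: var_commutator_in_kernel_iff[OF G.is_group eval_at_hom[OF G.is_group H.subgroup_axioms g]]
          eval_const_word eval_var_word)
    then have "var_commutator u \<in> equation_ideal G H g"
      by (simp add: kernel_def equation_ideal_def)
    then have "var_commutator u \<in> normal_closure E (var_commutator ` F')" using sub by blast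
    with uH F'(2) U(1) show "u \<in> generate G F'" by (intro commutator_in_finite_closure) auto
  qed
  with not_fg[OF F'] show False by blast
qed

text \<open>The trivial ideal is the normal closure of the empty set.\<close>

lemma algebraic_of_not_fin_gen:
  assumes g: "g \<in> carrier G" and "\<not> fin_gen_as_normal E (equation_ideal G H g)"
  shows "algebraic_elem G H g"
proof (rule ccontr)
  assume "\<not> algebraic_elem G H g"
  then have "equation_ideal G H g = {\<one>\<^bsub>E\<^esub>}"
    using algebraic_elem_iff_ideal[OF G.is_group H.subgroup_axioms g] by blast
  moreover have "normal_closure E {} = {\<one>\<^bsub>E\<^esub>}"
    using normal_closure_minimal[OF E.one_is_normal, of "{}"]
      subgroup.one_closed[OF normal_imp_subgroup[OF E.normal_closure_normal[of "{}"]]] by auto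
  ultimately have "fin_gen_as_normal E (equation_ideal G H g)"
    unfolding fin_gen_as_normal_def by (metis empty_subsetI finite.emptyI)
  with assms(2) show False by blast
qed

end

section \<open>Ideals over a subgroup of a product of two blocks\<close>

context group begin

lemma commute_generate:
  assumes "S \<subseteq> carrier G" "y \<in> carrier G" "\<And>s. s \<in> S \<Longrightarrow> s \<otimes> y = y \<otimes> s"
    and "z \<in> generate G S"
  shows "z \<otimes> y = y \<otimes> z"
proof -
  have "generate G S \<subseteq> {z \<in> carrier G. z \<otimes> y = y \<otimes> z}"
    using assms by (intro generate_subgroup_incl subgroup_centralizer) auto
  with assms(4) show ?thesis by auto
qed

lemma commute_generate_generate:
  assumes S: "S \<subseteq> carrier G" and T: "T \<subseteq> carrier G"
    and comm: "\<And>s t. s \<in> S \<Longrightarrow> t \<in> T \<Longrightarrow> s \<otimes> t = t \<otimes> s"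
    and z: "z \<in> generate G S" and w: "w \<in> generate G T"
  shows "z \<otimes> w = w \<otimes> z"
proof (rule commute_generate[OF S _ _ z])
  show "w \<in> carrier G" by (rule generate_in_carrier[OF T w])
  show "s \<otimes> w = w \<otimes> s" if s: "s \<in> S" for s
  proof (rule commute_generate[OF T _ _ w, symmetric])
    show "s \<in> carrier G" using s S by blast
    show "t \<otimes> s = s \<otimes> t" if "t \<in> T" for t using comm[OF s that] by simp
  qed
qed

lemma conj_pow_in_subgroup:
  assumes "subgroup K G" "a \<in> K" "c \<in> K"
  shows "conj_pow G a c k j \<in> K"
  unfolding conj_pow_def
  by (intro subgroup.m_closed[OF assms(1)] subgroup_int_pow_closed[OF assms(1)] assms)

lemma conj_word_in_subgroup:
  assumes "subgroup K G" "a \<in> K" "c \<in> K"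
  shows "conj_word G a c ks \<in> K"
proof (induction ks)
  case (Cons p ks)
  then show ?case
    using subgroup.m_closed[OF assms(1) conj_pow_in_subgroup[OF assms]] by (cases p) simp
qed (simp add: subgroup.one_closed[OF assms(1)])

text \<open>Used for \<open>\<alpha> = A Y\<close>, the diagonal element of two commuting blocks: conjugation by \<open>\<alpha>\<close> acts as
  conjugation by \<open>A\<close> on the first block and as conjugation by \<open>Y\<close> on the second one.\<close>

lemma conj_pow_mult_central:
  assumes abc: "a \<in> carrier G" "b \<in> carrier G" "c \<in> carrier G"
    and comm: "b \<otimes> a = a \<otimes> b" "b \<otimes> c = c \<otimes> b"
  shows "conj_pow G (a \<otimes> b) c k j = conj_pow G a c k j"
proof -
  have pow: "(a \<otimes> b) [^] i = a [^] i \<otimes> b [^] i" for i :: int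
    using abc comm by (intro int_pow_mult_distrib) auto
  have sub: "subgroup (generate G {b}) G" "subgroup (generate G {a, c}) G"
    using abc by (auto intro!: generate_is_subgroup)
  have bk: "b [^] k \<in> generate G {b}"
    by (intro subgroup_int_pow_closed sub generate.incl) simp
  have ca: "c [^] j \<otimes> a [^] (- k) \<in> generate G {a, c}"
    by (intro subgroup.m_closed subgroup_int_pow_closed sub generate.incl) simp_all
  have comm': "s \<otimes> t = t \<otimes> s" if "s \<in> {b}" "t \<in> {a, c}" for s t
    using that comm by blast
  have "b [^] k \<otimes> (c [^] j \<otimes> a [^] (- k)) = c [^] j \<otimes> a [^] (- k) \<otimes> b [^] k"
    by (rule commute_generate_generate[OF _ _ comm' bk ca]) (use abc in simp_all)
  then have "a [^] k \<otimes> (b [^] k \<otimes> (c [^] j \<otimes> a [^] (- k))) \<otimes> b [^] (- k)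
      = a [^] k \<otimes> (c [^] j \<otimes> a [^] (- k) \<otimes> b [^] k) \<otimes> b [^] (- k)"
    by simp
  then show ?thesis
    using abc by (simp add: conj_pow_def pow m_assoc int_pow_cancel')
qed

lemma conj_word_mult_central:
  assumes "a \<in> carrier G" "b \<in> carrier G" "c \<in> carrier G" "b \<otimes> a = a \<otimes> b" "b \<otimes> c = c \<otimes> b"
  shows "conj_word G (a \<otimes> b) c ks = conj_word G a c ks"
proof (induction ks)
  case (Cons p ks)
  then show ?case using conj_pow_mult_central[OF assms] by (cases p) simp
qed simp

lemma generate_conjugates_shift:
  assumes ac: "a \<in> carrier G" "c \<in> carrier G"
    and u: "u \<in> generate G (range (\<lambda>k. conj_pow G a c k 1))"
  shows "a [^] (i :: int) \<otimes> u \<otimes> a [^] (- i) \<in> generate G (range (\<lambda>k. conj_pow G a c k 1))"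
proof -
  let ?S = "range (\<lambda>k. conj_pow G a c k 1)" and ?f = "\<lambda>z. a [^] i \<otimes> z \<otimes> a [^] (- i)"
  have "?f (x \<otimes> y) = ?f x \<otimes> ?f y" if "x \<in> carrier G" "y \<in> carrier G" for x y
  proof -
    have "?f x \<otimes> ?f y = (a [^] i \<otimes> x) \<otimes> a [^] (- i) \<otimes> (a [^] i \<otimes> (y \<otimes> a [^] (- i)))"
      using that ac by (simp add: m_assoc)
    also have "\<dots> = (a [^] i \<otimes> x) \<otimes> (y \<otimes> a [^] (- i))"
      using that ac by (intro cancel_mid) (auto simp: int_pow_cancel)
    finally show ?thesis using that ac by (simp add: m_assoc)
  qed
  then interpret f: group_hom G G ?f
    using ac is_group by (auto simp: group_hom_def group_hom_axioms_def hom_def)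
  have "?f ` generate G ?S = generate G (?f ` ?S)"
    using ac by (intro f.generate_img[symmetric]) auto
  also have "\<dots> \<subseteq> generate G ?S"
    using ac by (intro mono_generate) (auto simp: conj_pow_shift)
  finally show ?thesis using u by blast
qed

text \<open>The construction for a group that contains two commuting pairs \<open>A, B\<close> and \<open>Y, C\<close>, one for each
  block: \<open>H\<close> is generated by \<open>A Y\<close> and \<open>B\<close>, and \<open>g = C\<close>.  The hypothesis \<open>free\<close> makes
  the subgroup \<open>U\<close> of \<open>H\<close> generated by the \<open>A\<^sup>k B A\<^sup>-\<^sup>k\<close> not finitely generated.  The hypothesis \<open>indep\<close> says
  that a normal form in the second pair is detected even after multiplication with elements
  of the first pair.  This matters in the quotients by the center, in which the blocks are no longer
  independent factors.\<close>

lemma exists_ideal_not_fin_gen: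
  assumes XY: "A \<in> carrier G" "B \<in> carrier G" "Y \<in> carrier G" "C \<in> carrier G"
    and comm: "\<And>s t. s \<in> {A, B} \<Longrightarrow> t \<in> {Y, C} \<Longrightarrow> s \<otimes> t = t \<otimes> s"
    and free: "free_conjugates G A B"
    and indep: "\<And>ks e u. reduced ks \<Longrightarrow> u \<in> generate G {A, B}
      \<Longrightarrow> conj_word G Y C ks \<otimes> (Y [^] (e :: int) \<otimes> u) = \<one> \<Longrightarrow> ks = [] \<and> e = 0"
  shows "\<exists>hs g. set hs \<subseteq> carrier G \<and> g \<in> carrier G \<and>
    algebraic_elem G (generate G (set hs)) g \<and>
    \<not> fin_gen_as_normal (adjoin_var G (generate G (set hs)))
        (equation_ideal G (generate G (set hs)) g)"
proof -
  define \<alpha> where "\<alpha> = A \<otimes> Y"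
  define H where "H = generate G {\<alpha>, B}"
  have \<alpha>: "\<alpha> \<in> carrier G" using XY by (simp add: \<alpha>_def)
  have H: "subgroup H G" unfolding H_def using XY \<alpha> by (intro generate_is_subgroup) simp
  interpret subgroup_equations G H
    using H is_group by (simp add: subgroup_equations_def)
  have \<alpha>H: "\<alpha> \<in> H" and BH: "B \<in> H" unfolding H_def by (auto intro: generate.incl)

  define U where "U = generate G (range (\<lambda>k. conj_pow G A B k 1))"
  have XB: "subgroup (generate G {A, B}) G" and YC: "subgroup (generate G {Y, C}) G"
    using XY by (auto intro!: generate_is_subgroup)
  have comm': "s \<otimes> t = t \<otimes> s" if "s \<in> generate G {A, B}" "t \<in> generate G {Y, C}" for s t
    by (rule commute_generate_generate[OF _ _ comm that]) (use XY in simp_all)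
  have \<alpha>_B: "conj_pow G \<alpha> B = conj_pow G A B"
    unfolding \<alpha>_def using XY comm[of A Y] comm[of B Y]
    by (intro ext conj_pow_mult_central) auto
  have \<alpha>_C: "conj_word G \<alpha> C ks = conj_word G Y C ks" for ks
  proof -
    have "\<alpha> = Y \<otimes> A" using comm[of A Y] by (simp add: \<alpha>_def)
    then show ?thesis
      using XY comm[of A Y] comm[of A C] conj_word_mult_central[of Y A C] by simp
  qed
  have \<alpha>_pow: "\<alpha> [^] e = A [^] e \<otimes> Y [^] e" for e :: int
    unfolding \<alpha>_def using XY comm[of A Y] by (intro int_pow_mult_distrib) auto
  have U: "subgroup U G" unfolding U_def using XY by (intro generate_is_subgroup) auto
  have U_XB: "U \<subseteq> generate G {A, B}"
    unfolding U_def
    by (intro generate_subgroup_incl XB image_subsetI conj_pow_in_subgroup[OF XB] generate.incl) simp_all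
  have UH: "U \<subseteq> H"
    unfolding U_def \<alpha>_B[symmetric]
    by (intro generate_subgroup_incl H image_subsetI conj_pow_in_subgroup \<alpha>H BH)
  have BU: "B \<in> U"
  proof -
    have "conj_pow G A B 0 1 = B" using XY by simp
    then show ?thesis unfolding U_def by (metis generate.incl rangeI)
  qed
  have U_shift: "\<alpha> [^] i \<otimes> u \<otimes> \<alpha> [^] (- i) \<in> U" if "u \<in> U" for u and i :: int
    using generate_conjugates_shift[OF \<alpha> XY(2), of u i] that by (simp add: U_def \<alpha>_B)
  have CYC: "C \<in> generate G {Y, C}" by (simp add: generate.incl)
  have UC: "C \<otimes> u = u \<otimes> C" if u: "u \<in> U" for u
    using comm'[OF subsetD[OF U_XB u] CYC] by simp
  have UE: "var_commutator ` U \<subseteq> carrier E" using UH by auto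

  \<comment> \<open>The relations \<open>[x, u] = 1\<close> suffice: every element is brought into normal form in the quotient
    by their normal closure.\<close>
  define N where "N = normal_closure E (var_commutator ` U)"
  have N: "N \<lhd> E" unfolding N_def by (rule E.normal_closure_normal[OF UE])
  interpret N: normal N E by (rule N)
  define \<pi> where "\<pi> w = N #>\<^bsub>E\<^esub> w" for w
  have \<pi>_hom: "\<pi> \<in> hom E (E Mod N)" unfolding \<pi>_def by (rule N.r_coset_hom_Mod)
  have Q: "group (E Mod N)" by (rule N.factorgroup_is_group)
  interpret Q: group "E Mod N" by (rule Q)
  interpret \<pi>: group_hom E "E Mod N" \<pi>
    using \<pi>_hom Q E.is_group by (simp add: group_hom_def group_hom_axioms_def)
  have \<pi>_kernel: "\<pi> w = \<one>\<^bsub>E Mod N\<^esub> \<longleftrightarrow> w \<in> N" if "w \<in> carrier E" for w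
    using that E.rcos_self[OF that N.subgroup_axioms] N.rcos_const by (auto simp: \<pi>_def FactGroup_def)

  let ?ev = "eval_at G C"
  interpret ev: group_hom E G ?ev
    using eval_at_hom[OF is_group H XY(4)] is_group E.is_group
    by (simp add: group_hom_def group_hom_axioms_def)
  have commutator_mem: "var_commutator u \<in> equation_ideal G H C" if "u \<in> U" for u
  proof -
    have "u \<in> H" using that UH by blast
    then have "var_commutator u \<in> kernel E G ?ev"
      using UC[OF that] XY by (simp add: var_commutator_in_kernel_iff[OF is_group ev.homh]
        eval_const_word eval_var_word)
    then show ?thesis by (simp add: kernel_def equation_ideal_def)
  qed
  have N_ideal: "N \<subseteq> equation_ideal G H C"
    unfolding N_def using commutator_mem
    by (intro normal_closure_minimal equation_ideal_normal is_group H XY) auto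

  define a where "a = const_word G H \<alpha>"
  define c where "c = var_word G H"
  have ac: "a \<in> carrier E" "c \<in> carrier E" using \<alpha>H by (simp_all add: a_def c_def)
  define S where "S = const_word G H ` U \<union> {a, c}"
  have S: "S \<subseteq> carrier E" using UH ac by (auto simp: S_def)
  have gS: "subgroup (generate E S) E" by (rule E.generate_is_subgroup[OF S])
  have carrier_gen: "carrier E \<subseteq> generate E S"
  proof -
    interpret k: group_hom GH E "const_word G H"
      using const_word_hom group_GH by (simp add: group_hom_def group_hom_axioms_def E.is_group)
    have "const_word G H ` H = const_word G H ` generate GH {\<alpha>, B}"
      using generate_consistent[OF _ H, of "{\<alpha>, B}"] \<alpha>H BH by (simp add: H_def)
    also have "\<dots> = generate E (const_word G H ` {\<alpha>, B})"
      using \<alpha>H BH by (intro k.generate_img[symmetric]) simp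
    also have "\<dots> \<subseteq> generate E S"
      using BU by (intro E.mono_generate) (auto simp: S_def a_def)
    finally have "const_word G H ` H \<subseteq> generate E S" .
    moreover have "var_word G H \<in> generate E S" by (auto simp: S_def c_def intro: generate.incl)
    ultimately have "generate E (const_word G H ` H \<union> {var_word G H}) \<subseteq> generate E S"
      by (intro E.generate_subgroup_incl gS) auto
    with carrier_generated show ?thesis by blast
  qed

  have ideal: "equation_ideal G H C \<subseteq> N"
  proof
    fix w assume w: "w \<in> equation_ideal G H C"
    then have wE: "w \<in> carrier E" and w1: "?ev w = \<one>" by (auto simp: equation_ideal_def)
    let ?P = "\<pi> ` const_word G H ` U"
    have P: "subgroup ?P (E Mod N)"
    proof -
      interpret k: group_hom GH E "const_word G H"
        using const_word_hom group_GH by (simp add: group_hom_def group_hom_axioms_def E.is_group)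
      have "subgroup U GH" using subgroup_incl[OF U H UH] .
      then show ?thesis by (intro \<pi>.subgroup_img_is_subgroup k.subgroup_img_is_subgroup)
    qed
    have "\<pi> w \<in> \<pi> ` generate E S" using carrier_gen wE by blast
    also have "\<pi> ` generate E S = generate (E Mod N) (\<pi> ` S)" using \<pi>.generate_img[OF S] by simp
    also have "\<pi> ` S = ?P \<union> {\<pi> a, \<pi> c}" by (auto simp: S_def)
    finally have mem: "\<pi> w \<in> generate (E Mod N) (?P \<union> {\<pi> a, \<pi> c})" .
    have Pc: "\<pi> c \<otimes>\<^bsub>E Mod N\<^esub> p = p \<otimes>\<^bsub>E Mod N\<^esub> \<pi> c" if p: "p \<in> ?P" for p
    proof -
      obtain u where u: "u \<in> U" "p = \<pi> (const_word G H u)" using p by blast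
      then have uH: "u \<in> H" using UH by blast
      have "var_commutator u \<in> N"
        unfolding N_def using normal_closure_superset[of _ E] u(1) by blast
      then have "var_commutator u \<in> kernel E (E Mod N) \<pi>"
        using uH \<pi>_kernel by (simp add: kernel_def)
      then show ?thesis
        using uH by (simp add: var_commutator_in_kernel_iff[OF Q \<pi>_hom] u(2) c_def)
    qed
    have a_pow: "a [^]\<^bsub>E\<^esub> i = const_word G H (\<alpha> [^] i)" for i :: int
      using \<alpha>H by (simp add: a_def const_word_int_pow)
    have \<alpha>_pow_H: "\<alpha> [^] i \<in> H" for i :: int
      by (rule subgroup_int_pow_closed[OF H \<alpha>H])
    have Pa: "\<pi> a [^]\<^bsub>E Mod N\<^esub> i \<otimes>\<^bsub>E Mod N\<^esub> p \<otimes>\<^bsub>E Mod N\<^esub> \<pi> a [^]\<^bsub>E Mod N\<^esub> (- i) \<in> ?P"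
      if p: "p \<in> ?P" for p and i :: int
    proof -
      obtain u where u: "u \<in> U" "p = \<pi> (const_word G H u)" using p by blast
      then have uH: "u \<in> H" using UH by blast
      have "\<pi> (const_word G H (\<alpha> [^] i \<otimes> u \<otimes> \<alpha> [^] (- i)))
          = \<pi> a [^]\<^bsub>E Mod N\<^esub> i \<otimes>\<^bsub>E Mod N\<^esub> p \<otimes>\<^bsub>E Mod N\<^esub> \<pi> a [^]\<^bsub>E Mod N\<^esub> (- i)"
        using uH \<alpha>_pow_H ac
        by (simp add: const_word_mult u(2) a_pow flip: \<pi>.hom_int_pow)
      then show ?thesis using U_shift[OF u(1), of i] by (metis imageI)
    qed
    obtain p ks e where p: "p \<in> ?P" and ks: "reduced ks"
      and \<pi>w: "\<pi> w = p \<otimes>\<^bsub>E Mod N\<^esub> (conj_word (E Mod N) (\<pi> a) (\<pi> c) ks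
        \<otimes>\<^bsub>E Mod N\<^esub> \<pi> a [^]\<^bsub>E Mod N\<^esub> (e :: int))"
      by (rule Q.conj_word_normal_form[OF P \<pi>.hom_closed[OF ac(1)] \<pi>.hom_closed[OF ac(2)] Pc Pa mem])
    obtain u where u: "u \<in> U" "p = \<pi> (const_word G H u)" using p by blast
    have uH: "u \<in> H" using u UH by blast
    have uG: "u \<in> carrier G" by (rule H.mem_carrier[OF uH])
    \<comment> \<open>The normal form lifted to the free product, where \<open>g\<close> can be substituted for \<open>x\<close>; it differs
      from \<open>w\<close> by an element of \<open>N\<close>, which substitution sends to \<open>1\<close>.\<close>
    define v where "v = const_word G H u \<otimes>\<^bsub>E\<^esub> (conj_word E a c ks \<otimes>\<^bsub>E\<^esub> a [^]\<^bsub>E\<^esub> e)"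
    have vE: "v \<in> carrier E" using uH ac by (simp add: v_def)
    have "\<pi> v = \<pi> w"
      using uH ac by (simp add: v_def \<pi>w u(2) \<pi>.hom_int_pow hom_conj_word[OF E.is_group Q \<pi>_hom])
    then have "\<pi> (w \<otimes>\<^bsub>E\<^esub> inv\<^bsub>E\<^esub> v)
        = \<pi> w \<otimes>\<^bsub>E Mod N\<^esub> inv\<^bsub>E Mod N\<^esub> \<pi> w"
      using vE wE by (simp only: \<pi>.hom_mult \<pi>.hom_inv E.inv_closed)
    also have "\<dots> = \<one>\<^bsub>E Mod N\<^esub>" by (rule Q.r_inv[OF \<pi>.hom_closed[OF wE]])
    finally have wv: "w \<otimes>\<^bsub>E\<^esub> inv\<^bsub>E\<^esub> v \<in> N" using vE wE by (subst \<pi>_kernel[symmetric]) simp_all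
    then have "?ev (w \<otimes>\<^bsub>E\<^esub> inv\<^bsub>E\<^esub> v) = \<one>" using N_ideal by (auto simp: equation_ideal_def)
    then have "?ev v = \<one>" using wE vE w1 by simp
    moreover have "?ev v = u \<otimes> (conj_word G Y C ks \<otimes> \<alpha> [^] e)"
      using uH \<alpha>H ac XY
      by (simp add: v_def ev.hom_int_pow hom_conj_word[OF E.is_group is_group ev.homh]
          eval_const_word eval_var_word a_def c_def \<alpha>_C)
    ultimately have one: "u \<otimes> (conj_word G Y C ks \<otimes> \<alpha> [^] e) = \<one>" by simp
    let ?W = "conj_word G Y C ks"
    have mem2: "?W \<in> generate G {Y, C}" "Y [^] e \<in> generate G {Y, C}" "A [^] e \<in> generate G {A, B}"
      using conj_word_in_subgroup[OF YC] subgroup_int_pow_closed[OF YC] subgroup_int_pow_closed[OF XB]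
      by (simp_all add: generate.incl)
    have uX: "u \<in> generate G {A, B}" using u(1) U_XB by blast
    have uX': "u \<otimes> A [^] e \<in> generate G {A, B}"
      using subgroup.m_closed[OF XB uX mem2(3)] .
    \<comment> \<open>Collecting the factors by pairs: the second pair contributes \<open>?W\<close> and \<open>Y\<^sup>e\<close>, the first pair
      \<open>u\<close> and \<open>A\<^sup>e\<close>.\<close>
    have "\<one> = u \<otimes> A [^] e \<otimes> (?W \<otimes> Y [^] e)"
    proof -
      have "?W \<otimes> \<alpha> [^] e = A [^] e \<otimes> (?W \<otimes> Y [^] e)"
        using comm'[OF mem2(3,1)] XY by (simp add: \<alpha>_pow flip: m_assoc)
      with one show ?thesis using XY uG by (simp add: m_assoc)
    qed
    also have "\<dots> = ?W \<otimes> Y [^] e \<otimes> (u \<otimes> A [^] e)"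
      using comm'[OF uX' subgroup.m_closed[OF YC mem2(1,2)]] .
    finally have "?W \<otimes> (Y [^] e \<otimes> (u \<otimes> A [^] e)) = \<one>" using XY uG by (simp add: m_assoc)
    from indep[OF ks uX' this] have e: "ks = []" "e = 0" by simp_all
    with one uG have "u = \<one>" by simp
    then have "v = \<one>\<^bsub>E\<^esub>" by (simp add: v_def e)
    with wv wE show "w \<in> N" by simp
  qed

  have not_fg: "\<not> U \<subseteq> generate G F" if F: "finite F" "F \<subseteq> U" for F
  proof -
    have "generate G F \<noteq> U"
      using free_conjugates_not_fin_gen[OF XY(1,2) free F(1)] F(2) by (simp add: U_def)
    moreover have "generate G F \<subseteq> U" by (rule generate_subgroup_incl[OF F(2) U])
    ultimately show ?thesis by blast
  qed
  have "\<not> fin_gen_as_normal E (equation_ideal G H C)"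
    by (rule equation_ideal_not_fin_gen[OF XY(4) UH UC ideal[unfolded N_def] not_fg])
  with algebraic_of_not_fin_gen[OF XY(4) this] XY \<alpha> show ?thesis
    by (intro exI[of _ "[\<alpha>, B]"] exI[of _ C]) (simp add: H_def)
qed

end

section \<open>Transvections and ping-pong\<close>

lemma SL_int_simps:
  "A \<in> carrier (SL_int n) \<Longrightarrow> A \<in> carrier_mat n n"
  "A \<otimes>\<^bsub>SL_int n\<^esub> B = A * B"
  "\<one>\<^bsub>SL_int n\<^esub> = 1\<^sub>m n"
  by (auto simp: SL_int_def GL_int_def units_of_def Units_def ring_mat_def)

lemma GL_int_simps:
  "A \<in> carrier (GL_int n) \<Longrightarrow> A \<in> carrier_mat n n"
  "A \<otimes>\<^bsub>GL_int n\<^esub> B = A * B"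
  "\<one>\<^bsub>GL_int n\<^esub> = 1\<^sub>m n"
  by (auto simp: GL_int_def units_of_def Units_def ring_mat_def)

lemma transvection_in_SL_int:
  assumes "i < n" "j < n" "i \<noteq> j"
  shows "addrow_mat n a i j \<in> carrier (SL_int n)"
  using addrow_mat_Unit[OF assms, of a "()"] det_addrow_mat[OF assms(3), of n a]
  by (simp add: SL_int_def GL_int_def units_of_def)

lemma transvection_mult_index:
  fixes M :: "'a :: comm_ring_1 mat"
  assumes "M \<in> carrier_mat n m" "r < n" "c < m" "j < n"
  shows "(addrow_mat n a i j * M) $$ (r, c) = (if r = i then a * M $$ (j, c) + M $$ (r, c) else M $$ (r, c))"
  using assms by (subst addrow_mat[symmetric, of _ _ m]) auto

lemma transvection_add:
  assumes "i < n" "j < n" "i \<noteq> j"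
  shows "addrow_mat n (a + b :: 'a :: comm_ring_1) i j = addrow_mat n a i j * addrow_mat n b i j"
  by (rule eq_matI) (use assms in \<open>auto simp: transvection_mult_index[of _ n n] simp del: index_mult_mat(1)\<close>)

lemma transvection_commute:
  assumes "i < n" "j < n" "k < n" "l < n" "i \<noteq> l" "j \<noteq> k"
  shows "addrow_mat n (a :: 'a :: comm_ring_1) i j * addrow_mat n b k l
    = addrow_mat n b k l * addrow_mat n a i j"
  by (rule eq_matI) (use assms in \<open>auto simp: transvection_mult_index[of _ n n] simp del: index_mult_mat(1)\<close>)

lemma transvection_int_pow:
  assumes "i < n" "j < n" "i \<noteq> j"
  shows "addrow_mat n a i j [^]\<^bsub>SL_int n\<^esub> (k :: int) = addrow_mat n (k * a) i j"
proof -
  interpret group_hom integer_group "SL_int n" "\<lambda>k. addrow_mat n (k * a) i j"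
    using assms
    by (auto simp: group_hom_def group_hom_axioms_def hom_def group_SL_int transvection_in_SL_int
        transvection_add SL_int_simps(2) distrib_right)
  show ?thesis using hom_int_pow[of 1 k] by simp
qed

lemma ping_pong_step:
  fixes d m q :: int
  assumes "\<bar>d\<bar> < \<bar>q\<bar>" "m \<noteq> 0"
  shows "\<bar>q\<bar> < \<bar>d + 2 * m * q\<bar>"
proof -
  have "1 \<le> \<bar>m\<bar>" using assms(2) by linarith
  then have "\<bar>q\<bar> \<le> \<bar>m\<bar> * \<bar>q\<bar>" using mult_right_mono[of 1 "\<bar>m\<bar>" "\<bar>q\<bar>"] by simp
  then have "2 * \<bar>q\<bar> \<le> \<bar>2 * m * q\<bar>" by (simp add: abs_mult)
  then show ?thesis using assms by linarith
qed

text \<open>Ping-pong on the entries \<open>p\<close> and \<open>q\<close> of a column in the rows \<open>r\<close> and \<open>s\<close>.  Consider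
  the regions \<open>\<bar>p - 2 k q\<bar> < \<bar>q\<bar>\<close>, that is, the intervals of radius \<open>1\<close> around the even integers \<open>2 k\<close> on the
  projective line.  The nonzero powers of the conjugate of \<open>B\<close> by \<open>A\<^sup>k\<close> map the complement of the closed interval
  around \<open>2 k\<close> into the open one, and the starting point is \<open>\<infinity>\<close>.\<close>

lemma transvections_ping_pong:
  assumes rs: "r < n" "s < n" "r \<noteq> s" and c: "c < n"
    and M: "M \<in> carrier (SL_int n)" "M $$ (s, c) = 0" "M $$ (r, c) \<noteq> 0"
    and ks: "reduced ks" "ks \<noteq> []"
  defines "A \<equiv> addrow_mat n 2 r s" and "B \<equiv> addrow_mat n 2 s r"
  shows "\<bar>(conj_word (SL_int n) A B ks * M) $$ (r, c)
      - 2 * fst (hd ks) * (conj_word (SL_int n) A B ks * M) $$ (s, c)\<bar>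
    < \<bar>(conj_word (SL_int n) A B ks * M) $$ (s, c)\<bar>"
  using ks
proof (induction ks)
  case (Cons x ks)
  interpret SL: group "SL_int n" by (rule group_SL_int)
  obtain k j where x: "x = (k, j)" by force
  have AB: "A \<in> carrier (SL_int n)" "B \<in> carrier (SL_int n)"
    using rs by (simp_all add: A_def B_def transvection_in_SL_int)
  have pow: "A [^]\<^bsub>SL_int n\<^esub> i = addrow_mat n (i * 2) r s"
    "B [^]\<^bsub>SL_int n\<^esub> i = addrow_mat n (i * 2) s r" for i :: int
    using rs by (simp_all add: A_def B_def transvection_int_pow)
  define M' where "M' = conj_word (SL_int n) A B ks * M"
  have M': "M' \<in> carrier (SL_int n)"
    using SL.m_closed[OF SL.conj_word_closed[OF AB] M(1)] by (simp add: M'_def SL_int_simps)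
  define p q where "p = M' $$ (r, c)" and "q = M' $$ (s, c)"
  \<comment> \<open>The syllable \<open>(k, j)\<close> acts in three steps: translate by \<open>- 2 k\<close>, apply \<open>B\<^sup>j\<close>, translate back.\<close>
  define M1 where "M1 = addrow_mat n (- k * 2) r s * M'"
  define M2 where "M2 = addrow_mat n (j * 2) s r * M1"
  define M3 where "M3 = addrow_mat n (k * 2) r s * M2"
  have car: "M' \<in> carrier_mat n n" "M1 \<in> carrier_mat n n" "M2 \<in> carrier_mat n n"
    using SL_int_simps(1)[OF M'] by (simp_all add: M1_def M2_def mult_carrier_mat[of _ n n])
  have "conj_word (SL_int n) A B (x # ks) * M
      = (conj_pow (SL_int n) A B k j \<otimes>\<^bsub>SL_int n\<^esub> conj_word (SL_int n) A B ks) \<otimes>\<^bsub>SL_int n\<^esub> M"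
    by (simp add: x SL_int_simps)
  also have "\<dots> = A [^]\<^bsub>SL_int n\<^esub> k \<otimes>\<^bsub>SL_int n\<^esub> (B [^]\<^bsub>SL_int n\<^esub> j \<otimes>\<^bsub>SL_int n\<^esub>
      (A [^]\<^bsub>SL_int n\<^esub> (- k) \<otimes>\<^bsub>SL_int n\<^esub> (conj_word (SL_int n) A B ks \<otimes>\<^bsub>SL_int n\<^esub> M)))"
    using AB M(1) unfolding conj_pow_def
    by (simp only: SL.m_assoc SL.m_closed SL.int_pow_closed SL.conj_word_closed)
  also have "\<dots> = M3"
    by (simp only: SL_int_simps pow M3_def M2_def M1_def M'_def)
  finally have W: "conj_word (SL_int n) A B (x # ks) * M = M3" .
  define p' where "p' = p - 2 * k * q"
  define q' where "q' = q + 2 * j * p'"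
  have "M1 $$ (r, c) = p'" "M1 $$ (s, c) = q"
    unfolding M1_def using car rs c
    by (simp_all add: transvection_mult_index[of _ n n] p_def q_def p'_def del: index_mult_mat(1))
  then have "M2 $$ (r, c) = p'" "M2 $$ (s, c) = q'"
    unfolding M2_def using car rs c
    by (simp_all add: transvection_mult_index[of _ n n] q'_def del: index_mult_mat(1))
  then have M3: "M3 $$ (r, c) = p' + 2 * k * q'" "M3 $$ (s, c) = q'"
    unfolding M3_def using car rs c
    by (simp_all add: transvection_mult_index[of _ n n] del: index_mult_mat(1))
  have j: "j \<noteq> 0" and red: "reduced ks" and hd: "ks = [] \<or> fst (hd ks) \<noteq> k"
    using Cons.prems by (simp_all add: x reduced_Cons)
  have "\<bar>q\<bar> < \<bar>p'\<bar>"
  proof (cases "ks = []")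
    case True
    then have "M' = M" using SL_int_simps(1)[OF M(1)] by (simp add: M'_def SL_int_simps)
    then show ?thesis using M by (simp add: p'_def p_def q_def)
  next
    case False
    let ?l = "fst (hd ks)"
    \<comment> \<open>The interval around \<open>2 l\<close> is disjoint from the one around \<open>2 k\<close>.\<close>
    have "\<bar>p - 2 * ?l * q\<bar> < \<bar>q\<bar>"
      using Cons.IH[OF red False] by (simp add: p_def q_def M'_def)
    then have "\<bar>q\<bar> < \<bar>(p - 2 * ?l * q) + 2 * (?l - k) * q\<bar>"
      using hd False by (intro ping_pong_step) auto
    then show ?thesis by (simp add: p'_def algebra_simps)
  qed
  then have "\<bar>p'\<bar> < \<bar>q'\<bar>" using j unfolding q'_def by (rule ping_pong_step)
  then show ?case unfolding W M3 by (simp add: x)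
qed simp

lemma generate_transvections_fix_row:
  assumes rs: "r < n" "s < n" "r \<noteq> s" and t: "t < n" "t \<noteq> r" "t \<noteq> s" and c: "c < n"
    and v: "v \<in> generate (SL_int n) {addrow_mat n a r s, addrow_mat n b s r}"
  shows "v $$ (t, c) = (if c = t then 1 else 0)"
proof -
  interpret SL: group "SL_int n" by (rule group_SL_int)
  define T where "T = {v \<in> carrier (SL_int n). v $$ (t, c) = (if c = t then 1 else 0)}"
  have step: "addrow_mat n d i j \<otimes>\<^bsub>SL_int n\<^esub> w \<in> T"
    if w: "w \<in> T" and ij: "(i, j) \<in> {(r, s), (s, r)}" for d i j w
  proof -
    have "(addrow_mat n d i j * w) $$ (t, c) = w $$ (t, c)"
      using ij rs t c w SL_int_simps(1)[of w n]
      by (subst transvection_mult_index[of _ n n]) (auto simp: T_def)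
    moreover have "addrow_mat n d i j \<otimes>\<^bsub>SL_int n\<^esub> w \<in> carrier (SL_int n)"
      using ij rs w by (intro SL.m_closed transvection_in_SL_int) (auto simp: T_def)
    ultimately show ?thesis using w by (simp add: T_def SL_int_simps)
  qed
  have inv: "inv\<^bsub>SL_int n\<^esub> addrow_mat n d i j = addrow_mat n (- d) i j"
    if "(i, j) \<in> {(r, s), (s, r)}" for d i j
  proof -
    have "addrow_mat n d i j \<in> carrier (SL_int n)"
      using that rs by (auto intro: transvection_in_SL_int)
    then have "inv\<^bsub>SL_int n\<^esub> addrow_mat n d i j = addrow_mat n d i j [^]\<^bsub>SL_int n\<^esub> (- 1 :: int)"
      by (simp add: SL.int_pow_neg)
    also have "\<dots> = addrow_mat n (- d) i j"
      using that rs by (subst transvection_int_pow) auto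
    finally show ?thesis .
  qed
  have "generate (SL_int n) {addrow_mat n a r s, addrow_mat n b s r} \<subseteq> T"
  proof (rule SL.generate_subset_of_left_closed)
    show "\<one>\<^bsub>SL_int n\<^esub> \<in> T" using t c SL.one_closed by (simp add: T_def SL_int_simps)
  next
    fix x w assume x: "x \<in> {addrow_mat n a r s, addrow_mat n b s r}" and w: "w \<in> T"
    from x obtain d i j where "(i, j) \<in> {(r, s), (s, r)}" "x = addrow_mat n d i j" by blast
    then show "x \<otimes>\<^bsub>SL_int n\<^esub> w \<in> T \<and> inv\<^bsub>SL_int n\<^esub> x \<otimes>\<^bsub>SL_int n\<^esub> w \<in> T"
      using step[OF w] inv by metis
  qed (use rs in \<open>auto simp: T_def transvection_in_SL_int\<close>)
  with v show ?thesis by (auto simp: T_def)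
qed

section \<open>Homomorphic images of the special linear group\<close>

text \<open>Nonempty reduced words in either block have a nonzero entry off the diagonal by ping-pong, and so does
  a power of \<open>Y\<close> with nonzero exponent, also after multiplication with an element of the first block.
  None of these lies in a kernel that consists of diagonal matrices.\<close>

lemma ideal_not_fin_gen_in_image:
  fixes G (structure)
  assumes n: "n \<ge> 4" and G: "group G" and f: "f \<in> hom (SL_int n) G"
    and ker: "\<And>M. M \<in> carrier (SL_int n) \<Longrightarrow> f M = \<one> \<Longrightarrow> diagonal_mat M"
  shows "\<exists>hs g. set hs \<subseteq> carrier G \<and> g \<in> carrier G \<and>
    algebraic_elem G (generate G (set hs)) g \<and>
    \<not> fin_gen_as_normal (adjoin_var G (generate G (set hs)))
        (equation_ideal G (generate G (set hs)) g)"
proof -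
  interpret G: group G by (rule G)
  interpret SL: group "SL_int n" by (rule group_SL_int)
  interpret f: group_hom "SL_int n" G f
    using f by (simp add: group_hom_def group_hom_axioms_def G group_SL_int)
  define A B Y C :: "int mat"
    where "A = addrow_mat n 2 0 1" and "B = addrow_mat n 2 1 0"
      and "Y = addrow_mat n 2 2 3" and "C = addrow_mat n 2 3 2"
  have car: "A \<in> carrier (SL_int n)" "B \<in> carrier (SL_int n)"
    "Y \<in> carrier (SL_int n)" "C \<in> carrier (SL_int n)"
    using n by (simp_all add: A_def B_def Y_def C_def transvection_in_SL_int)
  have entry: "M $$ (i, j) = 0"
    if "M \<in> carrier (SL_int n)" "f M = \<one>" "i < n" "j < n" "i \<noteq> j" for M i j
    using ker[OF that(1,2)] SL_int_simps(1)[OF that(1)] that(3-5) unfolding diagonal_mat_def by auto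
  show ?thesis
  proof (rule G.exists_ideal_not_fin_gen[of "f A" "f B" "f Y" "f C"])
    have comm: "f s \<otimes> f t = f t \<otimes> f s" if st: "s \<in> {A, B}" "t \<in> {Y, C}" for s t
    proof -
      obtain i j where s: "s = addrow_mat n 2 i j" "i < 2" "j < 2"
        using st(1) by (auto simp: A_def B_def)
      obtain k l where t: "t = addrow_mat n 2 k l" "k \<in> {2, 3}" "l \<in> {2, 3}"
        using st(2) by (auto simp: Y_def C_def)
      have "s * t = t * s"
        unfolding s t using s t n by (intro transvection_commute) auto
      moreover have "s \<in> carrier (SL_int n)" "t \<in> carrier (SL_int n)" using st car by auto
      ultimately show ?thesis by (simp flip: f.hom_mult add: SL_int_simps)
    qed
    show "s \<otimes> t = t \<otimes> s" if "s \<in> {f A, f B}" "t \<in> {f Y, f C}" for s t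
      using that comm[of A Y] comm[of A C] comm[of B Y] comm[of B C] by blast
    show "free_conjugates G (f A) (f B)"
      unfolding free_conjugates_def
    proof (intro allI impI)
      fix ks assume ks: "reduced ks" "conj_word G (f A) (f B) ks = \<one>"
      let ?W = "conj_word (SL_int n) A B ks"
      have W: "?W \<in> carrier (SL_int n)" using car by simp
      have "f ?W = \<one>" using ks by (simp add: hom_conj_word[OF group_SL_int G f car(1,2)])
      then have "?W $$ (1, 0) = 0" using n by (intro entry W) auto
      then have "(?W * 1\<^sub>m n) $$ (1, 0) = 0" using SL_int_simps(1)[OF W] by simp
      then show "ks = []"
        using transvections_ping_pong[of 0 n 1 0 "1\<^sub>m n" ks] ks(1) n SL.one_closed
        by (auto simp: A_def B_def SL_int_simps simp del: index_mult_mat(1))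
    qed
    fix ks u and e :: int
    assume ks: "reduced ks" and u: "u \<in> generate G {f A, f B}"
      and one: "conj_word G (f Y) (f C) ks \<otimes> (f Y [^] e \<otimes> u) = \<one>"
    have "generate G {f A, f B} = f ` generate (SL_int n) {A, B}"
      using f.generate_img[of "{A, B}"] car by simp
    with u obtain v where v: "v \<in> generate (SL_int n) {A, B}" "u = f v" by blast
    have v_car: "v \<in> carrier (SL_int n)"
      using SL.generate_in_carrier[OF _ v(1)] car by simp
    have v_rows: "v $$ (2, c) = (if c = 2 then 1 else 0)" "v $$ (3, c) = (if c = 3 then 1 else 0)"
      if "c < n" for c
      using generate_transvections_fix_row[of 0 n 1 _ c v 2 2] v(1) that n
      by (simp_all add: A_def B_def)
    \<comment> \<open>In the rows of the second block the factor \<open>v\<close> from the first block looks like the identity, so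
      column \<open>2\<close> of \<open>M\<close> is a legal starting point for ping-pong.\<close>
    define M where "M = addrow_mat n (e * 2) 2 3 * v"
    have Ye: "Y [^]\<^bsub>SL_int n\<^esub> e = addrow_mat n (e * 2) 2 3"
      using n by (simp add: Y_def transvection_int_pow)
    have M: "M \<in> carrier (SL_int n)" "f M = f Y [^] e \<otimes> u"
    proof -
      have eq: "M = Y [^]\<^bsub>SL_int n\<^esub> e \<otimes>\<^bsub>SL_int n\<^esub> v" by (simp add: Ye M_def SL_int_simps)
      show "M \<in> carrier (SL_int n)" unfolding eq using car v_car by simp
      show "f M = f Y [^] e \<otimes> u" unfolding eq using car v_car by (simp add: v(2) f.hom_int_pow)
    qed
    have M_entries: "M $$ (3, 2) = 0" "M $$ (2, 2) = 1" "M $$ (2, 3) = e * 2"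
      unfolding M_def using n SL_int_simps(1)[OF v_car] v_rows
      by (simp_all add: transvection_mult_index[of _ n n] del: index_mult_mat(1))
    let ?W = "conj_word (SL_int n) Y C ks"
    have W: "?W \<in> carrier (SL_int n)" using car by simp
    have WM: "?W * M \<in> carrier (SL_int n)"
      using SL.m_closed[OF W M(1)] by (simp add: SL_int_simps)
    have "f (?W * M) = \<one>"
      using f.hom_mult[OF W M(1)] one
      by (simp add: SL_int_simps M(2) hom_conj_word[OF group_SL_int G f car(3,4)])
    then have zero: "(?W * M) $$ (3, 2) = 0" "(?W * M) $$ (2, 3) = 0"
      using entry[OF WM] n by simp_all
    have "ks = []"
      using transvections_ping_pong[of 2 n 3 2 M ks] ks zero(1) M(1) M_entries n
      by (auto simp: Y_def C_def simp del: index_mult_mat(1))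
    moreover from this have "?W * M = M" using SL_int_simps(1)[OF M(1)] by (simp add: SL_int_simps)
    ultimately show "ks = [] \<and> e = 0" using zero(2) M_entries(3) by simp
  qed (use car in simp_all)
qed

lemma commutes_with_transvections_diagonal:
  fixes M :: "'a :: comm_ring_1 mat"
  assumes M: "M \<in> carrier_mat n n"
    and comm: "\<And>i j. i < n \<Longrightarrow> j < n \<Longrightarrow> i \<noteq> j \<Longrightarrow>
      M * addrow_mat n 1 i j = addrow_mat n 1 i j * M"
  shows "diagonal_mat M"
  unfolding diagonal_mat_def
proof (intro allI impI)
  fix l i assume li: "l < dim_row M" "i < dim_col M" "l \<noteq> i"
  then have lt: "l < n" "i < n" using M by auto
  have "M $$ (l, l) + M $$ (l, i) = (addcol 1 l i M) $$ (l, l)"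
    using M lt li by (simp add: add.commute)
  also have "\<dots> = (M * addrow_mat n 1 i l) $$ (l, l)"
    by (subst addcol_mat[OF M lt(2)]) simp
  also have "\<dots> = (addrow_mat n 1 i l * M) $$ (l, l)" using comm lt li by simp
  also have "\<dots> = M $$ (l, l)"
    using M lt li by (simp add: transvection_mult_index[of _ n n] del: index_mult_mat(1))
  finally show "M $$ (l, i) = 0" by simp
qed

lemma SL_int_subset_GL_int: "carrier (SL_int n) \<subseteq> carrier (GL_int n)"
  by (auto simp: SL_int_def)

lemma center_diagonal:
  assumes "carrier (SL_int n) \<subseteq> carrier G" "carrier G \<subseteq> carrier_mat n n"
    and "\<And>A B. A \<otimes>\<^bsub>G\<^esub> B = A * B" and "M \<in> group_center G"
  shows "diagonal_mat M"
proof (rule commutes_with_transvections_diagonal)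
  have M: "M \<in> carrier G" "\<And>y. y \<in> carrier G \<Longrightarrow> M * y = y * M"
    using assms(3,4) by (auto simp: group_center_def)
  show "M \<in> carrier_mat n n" using M(1) assms(2) by blast
  show "M * addrow_mat n 1 i j = addrow_mat n 1 i j * M" if "i < n" "j < n" "i \<noteq> j" for i j
    using transvection_in_SL_int[OF that] assms(1) by (intro M(2)) blast
qed

theorem corollary4p5:
  fixes n :: nat
  assumes "n \<ge> 4"
  shows
    "(\<exists>hs g. set hs \<subseteq> carrier (GL_int n) \<and> g \<in> carrier (GL_int n) \<and>
      algebraic_elem (GL_int n) (generate (GL_int n) (set hs)) g \<and>
      \<not> fin_gen_as_normal (adjoin_var (GL_int n) (generate (GL_int n) (set hs)))
          (equation_ideal (GL_int n) (generate (GL_int n) (set hs)) g)) \<and>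
     (\<exists>hs g. set hs \<subseteq> carrier (PGL_int n) \<and> g \<in> carrier (PGL_int n) \<and>
      algebraic_elem (PGL_int n) (generate (PGL_int n) (set hs)) g \<and>
      \<not> fin_gen_as_normal (adjoin_var (PGL_int n) (generate (PGL_int n) (set hs)))
          (equation_ideal (PGL_int n) (generate (PGL_int n) (set hs)) g)) \<and>
     (\<exists>hs g. set hs \<subseteq> carrier (SL_int n) \<and> g \<in> carrier (SL_int n) \<and>
      algebraic_elem (SL_int n) (generate (SL_int n) (set hs)) g \<and>
      \<not> fin_gen_as_normal (adjoin_var (SL_int n) (generate (SL_int n) (set hs)))
          (equation_ideal (SL_int n) (generate (SL_int n) (set hs)) g)) \<and>
     (\<exists>hs g. set hs \<subseteq> carrier (PSL_int n) \<and> g \<in> carrier (PSL_int n) \<and>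
      algebraic_elem (PSL_int n) (generate (PSL_int n) (set hs)) g \<and>
      \<not> fin_gen_as_normal (adjoin_var (PSL_int n) (generate (PSL_int n) (set hs)))
          (equation_ideal (PSL_int n) (generate (PSL_int n) (set hs)) g))"
proof -
  interpret GL: group "GL_int n" by (rule group_GL_int)
  interpret SL: group "SL_int n" by (rule group_SL_int)
  interpret ZG: normal "group_center (GL_int n)" "GL_int n"
    by (rule group_center_normal[OF group_GL_int])
  interpret ZS: normal "group_center (SL_int n)" "SL_int n"
    by (rule group_center_normal[OF group_SL_int])
  have incl: "(\<lambda>M. M) \<in> hom (SL_int n) (GL_int n)"
    using SL_int_subset_GL_int[of n] by (auto simp: hom_def SL_int_simps GL_int_simps)
  have id: "(\<lambda>M. M) \<in> hom (SL_int n) (SL_int n)" by (simp add: hom_def)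
  have PSL: "(\<lambda>M. group_center (SL_int n) #>\<^bsub>SL_int n\<^esub> M) \<in> hom (SL_int n) (PSL_int n)"
    unfolding PSL_int_def by (rule ZS.r_coset_hom_Mod)
  have PGL: "(\<lambda>M. group_center (GL_int n) #>\<^bsub>GL_int n\<^esub> M) \<in> hom (SL_int n) (PGL_int n)"
    using hom_compose[OF incl ZG.r_coset_hom_Mod] by (simp add: PGL_int_def comp_def)
  have one: "diagonal_mat (1\<^sub>m n :: int mat)" by (simp add: diagonal_mat_def)
  have "diagonal_mat M" if "M \<in> carrier (SL_int n)"
    "group_center (SL_int n) #>\<^bsub>SL_int n\<^esub> M = \<one>\<^bsub>PSL_int n\<^esub>" for M
  proof -
    have "M \<in> group_center (SL_int n)"
      using that SL.rcos_self[OF that(1) ZS.subgroup_axioms] by (simp add: PSL_int_def FactGroup_def)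
    then show ?thesis by (intro center_diagonal) (auto simp: SL_int_simps)
  qed
  moreover have "diagonal_mat M" if M: "M \<in> carrier (SL_int n)"
    "group_center (GL_int n) #>\<^bsub>GL_int n\<^esub> M = \<one>\<^bsub>PGL_int n\<^esub>" for M
  proof -
    have "M \<in> carrier (GL_int n)" using M(1) SL_int_subset_GL_int by blast
    from GL.rcos_self[OF this ZG.subgroup_axioms] have "M \<in> group_center (GL_int n)"
      using M by (simp add: PGL_int_def FactGroup_def)
    then show ?thesis
      using SL_int_subset_GL_int[of n] by (intro center_diagonal) (auto simp: GL_int_simps)
  qed
  ultimately show ?thesis
    using ideal_not_fin_gen_in_image[OF assms group_GL_int incl]
      ideal_not_fin_gen_in_image[OF assms group_PGL_int PGL]
      ideal_not_fin_gen_in_image[OF assms group_SL_int id]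
      ideal_not_fin_gen_in_image[OF assms group_PSL_int PSL]
    by (simp add: SL_int_simps GL_int_simps one)
qed

end
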